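(* Let $p$ be an odd prime, $k$ a positive integer, $q$ a prime power and $n$ a positive integer. If $q$ is not a power of $p$, then $EGZ(p,\mathbb{F}_q^n,p-1)=\infty$. If $q=p^k$, then, as $n\to\infty$ (with $p,k$ fixed), $$ EGZ(p, \mathbb{F}_q^n, p-1) \leq \begin{cases} q^{n + o(n)} &\text{ for } p=3,5 \text{ and } k=1, \\ (2.756^k +1)^{n + o(n)} &\text{ for } p=3 \text{ and } k \geq 2, \\ \left(2^k \sqrt{q}+1 \right)^{n+o(n)} &\text{ for } p \neq 3 \text{ and } q \geq 7. \end{cases} $$
   Context: $\mathbb{F}_q^n$ is viewed as a commutative ring with coordinatewise operations. For elements $g_1,\dots,g_t$ of a commutative ring $R$, $e_m(g_1,\dots,g_t)=\sum_{1\leq i_1<\cdots<i_m\leq t}\prod_{j=1}^m g_{i_j}$. A sequence over $R$ is a finite list of elements of $R$ (repetitions allowed); a subsequence of length $t$ is obtained by choosing $t$ distinct positions. For a finite commutative ring $R$, $EGZ(t,R,m)$ is the smallest positive integer $\ell$ such that every sequence $S$ over $R$ of length $|S|\geq \ell$ contains a subsequence $S'$ of length $t$ with $e_m(S')=0$ in $R$; if no such $\ell$ exists, $EGZ(t,R,m)=\infty$. *)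

theory Defs
  imports Complex_Main "HOL-Library.Extended_Nat" "HOL-Library.Landau_Symbols" "HOL-Library.Cardinality" "HOL-Computational_Algebra.Primes"
begin

definition esym :: "nat \<Rightarrow> (nat \<Rightarrow> 'a::comm_ring_1) \<Rightarrow> nat set \<Rightarrow> 'a" where
  "esym m g T = (\<Sum>U\<in>{U. U \<subseteq> T \<and> card U = m}. \<Prod>i\<in>U. g i)"

text \<open>A sequence of length L over F_q^n is S :: nat => nat => 'a, where S i (i < L) is the
  i-th term and S i j (j < n) its j-th coordinate.  Operations in F_q^n are coordinatewise,
  so e_m(S') = 0 in F_q^n iff e_m of each coordinate vanishes.\<close>
definition egz_good :: "nat \<Rightarrow> nat \<Rightarrow> nat \<Rightarrow> 'a::field itself \<Rightarrow> nat \<Rightarrow> bool" where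
  "egz_good t n m _ l \<longleftrightarrow>
     (\<forall>L\<ge>l. \<forall>S :: nat \<Rightarrow> nat \<Rightarrow> 'a.
        \<exists>T. T \<subseteq> {..<L} \<and> card T = t \<and> (\<forall>j<n. esym m (\<lambda>i. S i j) T = 0))"

definition EGZ :: "nat \<Rightarrow> 'a::field itself \<Rightarrow> nat \<Rightarrow> nat \<Rightarrow> enat" where
  "EGZ t F n m = (if \<exists>l>0. egz_good t n m F l
                  then enat (LEAST l. l > 0 \<and> egz_good t n m F l) else \<infinity>)"

definition asymp_bound :: "(nat \<Rightarrow> enat) \<Rightarrow> real \<Rightarrow> bool" where
  "asymp_bound f B \<longleftrightarrow> (\<exists>h :: nat \<Rightarrow> real. h \<in> o(\<lambda>n. real n) \<and>
     (\<forall>\<^sub>F n in sequentially. \<exists>N. f n = enat N \<and> real N \<le> B powr (real n + h n)))"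

end

theory Submission
  imports Defs "HOL-Library.FuncSet" "HOL-Library.Function_Algebras" "HOL-Number_Theory.Residues"
begin

text \<open>If \<open>p \<noteq> 0\<close> in \<open>\<F>\<^sub>q\<close>, the constant sequence \<open>1\<close> has no good subsequence. Otherwise sort the terms by
  the set of coordinates in which they do not vanish: for \<open>p\<close> terms of one class, \<open>e\<^bsub>p-1\<^esub> = 0\<close> as soon as
  their coordinatewise inverses sum to zero, so a bound \<open>K B\<^bsup>m\<^esup>\<close> for sets of vectors with \<open>m\<close> coordinates
  without \<open>p\<close> distinct elements summing to zero yields \<open>(p - 1) K (B + 1)\<^bsup>n\<^esup>\<close> by the binomial theorem.

  For \<open>p = 3\<close> such a bound is the slice rank bound for cap sets. For general \<open>p\<close>, slice rank only shows
  that a set \<open>I\<close> of more than \<open>3 \<cdot> 4\<^bsup>km\<^esup>\<close> vectors contains a non-constant \<open>p\<close>-tuple with sum zero. Call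
  \<open>v\<close> robust if it is a sum of distinct elements of \<open>A\<close> avoiding any given small set. All but \<open>O(q\<^sup>m)\<close> pairs
  \<open>(z, w)\<close> of elements of \<open>A\<close> have all \<open>j z + l w\<close> with \<open>j, l \<ge> 1\<close>, \<open>j + l \<le> p\<close> robust, so by Turan's theorem
  \<open>A\<close> has a subset \<open>I\<close> of size at least a constant times \<open>\<bar>A\<bar>\<^sup>2 / q\<^sup>m\<close> all of whose pairs are of this kind.
  A zero-sum tuple from \<open>I\<close> can then be regrouped into \<open>p\<close> distinct elements of \<open>A\<close>, whence
  \<open>\<bar>A\<bar>\<^sup>2 = O(4\<^bsup>km\<^esup> q\<^sup>m)\<close>.\<close>

section \<open>Slice rank\<close>

text \<open>With \<open>q = CARD('a)\<close> there are \<open>q ^ card D\<close> vectors on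
  \<open>D\<close> but at most \<open>q ^ card L\<close> tuples of values on \<open>L\<close>, so
  two vectors share all values and their difference works.\<close>

lemma ex_orthogonal_vector:
  fixes L :: "('v \<Rightarrow> 'a::{finite,field}) set"
  assumes D: "finite D" and L: "finite L" and card: "card L < card D"
  shows "\<exists>v. (\<exists>a\<in>D. v a \<noteq> 0) \<and> (\<forall>a. a \<notin> D \<longrightarrow> v a = 0) \<and> (\<forall>f\<in>L. (\<Sum>a\<in>D. v a * f a) = 0)"
proof -
  let ?X = "D \<rightarrow>\<^sub>E (UNIV :: 'a set)"
  let ?Y = "L \<rightarrow>\<^sub>E (UNIV :: 'a set)"
  define \<Phi> where "\<Phi> u = (\<lambda>f\<in>L. \<Sum>a\<in>D. u a * f a)" for u :: "'v \<Rightarrow> 'a"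
  have "CARD('a) > 1"
    using card_mono[of UNIV "{0, 1 :: 'a}"] by simp
  hence "card ?Y < card ?X"
    using assms by (simp add: card_PiE)
  moreover have "\<Phi> ` ?X \<subseteq> ?Y"
    by (auto simp: \<Phi>_def)
  moreover have "finite ?Y"
    using L by (simp add: finite_PiE)
  ultimately have "card (\<Phi> ` ?X) < card ?X"
    by (meson card_mono le_less_trans)
  then have "\<not> inj_on \<Phi> ?X"
    using pigeonhole by blast
  then obtain u w where u: "u \<in> ?X" and w: "w \<in> ?X" and "u \<noteq> w" and eq: "\<Phi> u = \<Phi> w"
    by (auto simp: inj_on_def)
  define v where "v a = (if a \<in> D then u a - w a else 0)" for a
  have "\<exists>a\<in>D. v a \<noteq> 0"
    using PiE_ext[OF u w] \<open>u \<noteq> w\<close> by (fastforce simp: v_def)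
  moreover have "(\<Sum>a\<in>D. v a * f a) = 0" if "f \<in> L" for f
  proof -
    have "\<Phi> u f = \<Phi> w f" using eq by simp
    thus ?thesis using that by (simp add: \<Phi>_def v_def left_diff_distrib sum_subtractf)
  qed
  ultimately show ?thesis
    by (intro exI[of _ v]) (auto simp: v_def)
qed

text \<open>Take an orthogonal \<open>v\<close> of maximal support. If it vanished at more than
  \<open>card L\<close> points of \<open>A\<close>, a nonzero orthogonal vector living on those
  points could be added, enlarging the support.\<close>

lemma ex_orthogonal_vector_large_support:
  fixes L :: "('v \<Rightarrow> 'a::{finite,field}) set"
  assumes A: "finite A" and L: "finite L"
  shows "\<exists>v. card A \<le> card {a\<in>A. v a \<noteq> 0} + card L \<and> (\<forall>f\<in>L. (\<Sum>a\<in>A. v a * f a) = 0)"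
proof -
  define P where "P s \<longleftrightarrow> (\<exists>v. card {a\<in>A. v a \<noteq> 0} = s \<and> (\<forall>f\<in>L. (\<Sum>a\<in>A. v a * f a) = 0))" for s
  have P0: "P 0"
    unfolding P_def by (rule exI[of _ "\<lambda>_. 0"]) simp
  have bnd: "s \<le> card A" if "P s" for s
    using that A by (auto simp: P_def intro: card_mono)
  define s where "s = (GREATEST s. P s)"
  have "P s" and max: "P s' \<Longrightarrow> s' \<le> s" for s'
    unfolding s_def using GreatestI_nat[of P 0 "card A"] Greatest_le_nat[of P _ "card A"] P0 bnd by blast+
  then obtain v where v: "card {a\<in>A. v a \<noteq> 0} = s" "\<forall>f\<in>L. (\<Sum>a\<in>A. v a * f a) = 0"
    by (auto simp: P_def)
  have "card A \<le> s + card L"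
  proof (rule ccontr)
    assume neg: "\<not> ?thesis"
    define D where "D = {a\<in>A. v a = 0}"
    have "card A = card D + s"
      unfolding v(1)[symmetric] D_def using A
      by (subst card_Un_disjoint[symmetric]) (auto intro: arg_cong[of _ _ card])
    hence "card L < card D" using neg by simp
    moreover have "finite D" using A by (simp add: D_def)
    ultimately obtain u where u: "\<exists>a\<in>D. u a \<noteq> 0" "\<forall>a. a \<notin> D \<longrightarrow> u a = 0"
        "\<forall>f\<in>L. (\<Sum>a\<in>D. u a * f a) = 0"
      using ex_orthogonal_vector[of D L] L by blast
    have "(\<Sum>a\<in>A. (v a + u a) * f a) = 0" if "f \<in> L" for f
    proof -
      have "(\<Sum>a\<in>A. u a * f a) = (\<Sum>a\<in>D. u a * f a)"
        using u(2) A by (intro sum.mono_neutral_right) (auto simp: D_def)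
      thus ?thesis using u(3) v(2) that by (simp add: distrib_right sum.distrib)
    qed
    hence "P (card {a\<in>A. v a + u a \<noteq> 0})"
      unfolding P_def by (intro exI[of _ "\<lambda>a. v a + u a"]) blast
    moreover have "{a\<in>A. v a \<noteq> 0} \<subset> {a\<in>A. v a + u a \<noteq> 0}"
      using u(1,2) by (auto simp: D_def psubset_eq)
    hence "s < card {a\<in>A. v a + u a \<noteq> 0}"
      unfolding v(1)[symmetric] using A by (intro psubset_card_mono) auto
    ultimately show False using max by fastforce
  qed
  thus ?thesis using v by blast
qed

lemma sum_prod_weights:
  fixes f w :: "nat \<Rightarrow> 'v \<Rightarrow> 'a::comm_ring_1"
  assumes "finite A"
  shows "(\<Sum>x\<in>{..<t} \<rightarrow>\<^sub>E A. (\<Prod>j<t. w j (x j)) * (\<Prod>j<t. f j (x j))) = (\<Prod>j<t. \<Sum>a\<in>A. w j a * f j a)"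
  using assms by (subst prod_sum_PiE) (auto simp: prod.distrib)

text \<open>Slice rank of a diagonal tensor: contracting with vectors orthogonal to the slices kills
  every term but not the diagonal. Choosing \<open>v\<close> costs \<open>card L\<close> points of
  \<open>A\<close> and choosing \<open>u\<close> on its support costs \<open>2 * card L\<close>
  more, whence the factor 3, whatever \<open>t\<close> is.\<close>

lemma diagonal_slice_bound:
  fixes f :: "'\<tau> \<Rightarrow> nat \<Rightarrow> 'v \<Rightarrow> 'a::{finite,field}"
  assumes A: "finite A" and L: "finite L" and Ts: "finite Ts" and t: "t \<ge> 2"
    and diag: "\<And>x. (\<And>j. j < t \<Longrightarrow> x j \<in> A) \<Longrightarrow>
      (\<Sum>\<tau>\<in>Ts. c \<tau> * (\<Prod>j<t. f \<tau> j (x j))) = (if \<forall>j<t. x j = x 0 then 1 else 0)"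
    and slice: "\<And>\<tau>. \<tau> \<in> Ts \<Longrightarrow> \<exists>j<t. f \<tau> j \<in> L"
  shows "card A \<le> 3 * card L"
proof (rule ccontr)
  assume neg: "\<not> ?thesis"
  obtain v where v: "card A \<le> card {a\<in>A. v a \<noteq> 0} + card L"
      and vL: "\<forall>f\<in>L. (\<Sum>a\<in>A. v a * f a) = 0"
    using ex_orthogonal_vector_large_support[OF A L] by blast
  define B where "B = {a\<in>A. v a \<noteq> 0}"
  have B: "finite B" "B \<subseteq> A" using A by (auto simp: B_def)
  \<comment> \<open>\<open>G l\<close> gathers the slot 1 factors of all terms carrying
    \<open>l\<close> in slot 0, with the later slots already contracted with \<open>v\<close>.
    Orthogonality of \<open>u\<close> to \<open>G l\<close> kills these terms jointly.\<close>
  define G where "G l b = (\<Sum>\<tau>\<in>{\<tau>\<in>Ts. f \<tau> 0 = l}. c \<tau> * f \<tau> 1 b * (\<Prod>j\<in>{2..<t}. \<Sum>a\<in>A. v a * f \<tau> j a))"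
    for l b
  have "card (L \<union> G ` L) \<le> card L + card L"
    using card_Un_le[of L "G ` L"] card_image_le[OF L, of G] by linarith
  also have "\<dots> < card B" using v neg by (simp add: B_def)
  finally have "card (L \<union> G ` L) < card B" .
  then obtain u where u: "\<exists>a\<in>B. u a \<noteq> 0" "\<forall>a. a \<notin> B \<longrightarrow> u a = 0"
      and uLG: "\<forall>f\<in>L \<union> G ` L. (\<Sum>a\<in>B. u a * f a) = 0"
    using ex_orthogonal_vector[of B "L \<union> G ` L"] B L by blast
  have uB: "(\<Sum>a\<in>A. u a * g a) = (\<Sum>a\<in>B. u a * g a)" for g
    using A u(2) B by (intro sum.mono_neutral_right) auto
  from u(1) obtain a0 where a0: "a0 \<in> B" "u a0 \<noteq> 0" by blast
  \<comment> \<open>Slot 0 is evaluated at \<open>a0\<close>, slot 1 paired with \<open>u\<close>,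
    later slots with \<open>v\<close>. The diagonal then contributes only
    \<open>u a0 * v a0 ^ (t - 2)\<close>, which is nonzero.\<close>
  define w where "w j a = (if j = 0 then of_bool (a = a0) else if j = 1 then u a else v a)"
    for j :: nat and a
  have split: "(\<Prod>j<t. g j) = g 0 * g 1 * (\<Prod>j\<in>{2..<t}. g j)" for g :: "nat \<Rightarrow> 'a"
  proof -
    have "{..<t} = insert 0 (insert 1 {2..<t})" using t by auto
    thus ?thesis by (simp add: mult.assoc)
  qed
  define F where "F x = (\<Sum>\<tau>\<in>Ts. c \<tau> * (\<Prod>j<t. f \<tau> j (x j)))" for x :: "nat \<Rightarrow> 'v"
  let ?X = "{..<t} \<rightarrow>\<^sub>E A"
  have finX: "finite ?X" using A by (simp add: finite_PiE)
  define S where "S = (\<Sum>x\<in>?X. (\<Prod>j<t. w j (x j)) * F x)"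
  have "S = (\<Sum>x\<in>{\<lambda>j\<in>{..<t}. a0}. (\<Prod>j<t. w j (x j)) * F x)"
    unfolding S_def
  proof (intro sum.mono_neutral_right ballI)
    show "{\<lambda>j\<in>{..<t}. a0} \<subseteq> ?X" using a0 B by auto
    fix x assume x: "x \<in> ?X - {\<lambda>j\<in>{..<t}. a0}"
    show "(\<Prod>j<t. w j (x j)) * F x = 0"
    proof (cases "x 0 = a0")
      case True
      have "\<not> (\<forall>j<t. x j = x 0)"
      proof
        assume "\<forall>j<t. x j = x 0"
        hence "x = (\<lambda>j\<in>{..<t}. a0)" using x True by (auto simp: fun_eq_iff PiE_def extensional_def)
        thus False using x by simp
      qed
      hence "F x = 0" unfolding F_def using x by (subst diag) auto
      thus ?thesis by simp
    next
      case False
      thus ?thesis by (simp add: split w_def)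
    qed
  qed (fact finX)
  also have "\<dots> = u a0 * v a0 ^ (t - 2)"
  proof -
    have "F (\<lambda>j\<in>{..<t}. a0) = 1"
      unfolding F_def using a0 B t by (subst diag) auto
    moreover have "(\<Prod>j<t. w j ((\<lambda>j\<in>{..<t}. a0) j)) = u a0 * v a0 ^ (t - 2)"
      using t by (simp add: split w_def)
    ultimately show ?thesis by simp
  qed
  finally have S1: "S \<noteq> 0" using a0 by (auto simp: B_def)
  have "S = (\<Sum>\<tau>\<in>Ts. c \<tau> * (\<Sum>x\<in>?X. (\<Prod>j<t. w j (x j)) * (\<Prod>j<t. f \<tau> j (x j))))"
    unfolding S_def F_def sum_distrib_left
    by (subst sum.swap) (simp add: mult_ac)
  also have "\<dots> = (\<Sum>\<tau>\<in>Ts. c \<tau> * (\<Prod>j<t. \<Sum>a\<in>A. w j a * f \<tau> j a))"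
    by (simp add: sum_prod_weights[OF A])
  also have "\<dots> = (\<Sum>\<tau>\<in>Ts. c \<tau> * (f \<tau> 0 a0 * (\<Sum>b\<in>A. u b * f \<tau> 1 b) * (\<Prod>j\<in>{2..<t}. \<Sum>a\<in>A. v a * f \<tau> j a)))"
    (is "_ = (\<Sum>\<tau>\<in>Ts. ?h \<tau>)")
  proof (intro sum.cong refl arg_cong2[where f = "(*)"])
    fix \<tau>
    have "(\<Sum>a\<in>A. w 0 a * f \<tau> 0 a) = (\<Sum>a\<in>{a0}. w 0 a * f \<tau> 0 a)"
      using A a0 B by (intro sum.mono_neutral_right) (auto simp: w_def)
    thus "(\<Prod>j<t. \<Sum>a\<in>A. w j a * f \<tau> j a) = f \<tau> 0 a0 * (\<Sum>b\<in>A. u b * f \<tau> 1 b) * (\<Prod>j\<in>{2..<t}. \<Sum>a\<in>A. v a * f \<tau> j a)"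
      by (simp add: split w_def)
  qed
  \<comment> \<open>A term without a factor from \<open>L\<close> in slot 0 has one in a later slot,
    where \<open>u\<close> or \<open>v\<close> annihilates it.\<close>
  also have "\<dots> = (\<Sum>\<tau>\<in>{\<tau>\<in>Ts. f \<tau> 0 \<in> L}. ?h \<tau>)"
  proof (intro sum.mono_neutral_right ballI)
    fix \<tau> assume \<tau>: "\<tau> \<in> Ts - {\<tau>\<in>Ts. f \<tau> 0 \<in> L}"
    then obtain j where j: "j < t" "f \<tau> j \<in> L" "j \<noteq> 0" using slice by (metis DiffE mem_Collect_eq)
    show "?h \<tau> = 0"
    proof (cases "j = 1")
      case True
      thus ?thesis using j uLG by (simp add: uB)
    next
      case False
      hence "(\<Prod>j\<in>{2..<t}. \<Sum>a\<in>A. v a * f \<tau> j a) = 0"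
        using j vL by (intro prod_zero) (auto intro!: bexI[of _ j])
      thus ?thesis by simp
    qed
  qed (use Ts in auto)
  also have "\<dots> = (\<Sum>l\<in>L. \<Sum>\<tau>\<in>{\<tau>\<in>{\<tau>\<in>Ts. f \<tau> 0 \<in> L}. f \<tau> 0 = l}. ?h \<tau>)"
    by (rule sum.group[symmetric]) (use Ts L in auto)
  also have "\<dots> = (\<Sum>l\<in>L. l a0 * (\<Sum>b\<in>A. u b * G l b))"
  proof (intro sum.cong refl)
    fix l assume l: "l \<in> L"
    have "(\<Sum>\<tau>\<in>{\<tau>\<in>{\<tau>\<in>Ts. f \<tau> 0 \<in> L}. f \<tau> 0 = l}. ?h \<tau>) = (\<Sum>\<tau>\<in>{\<tau>\<in>Ts. f \<tau> 0 = l}. ?h \<tau>)"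
      using l by (intro sum.cong) auto
    also have "\<dots> = (\<Sum>\<tau>\<in>{\<tau>\<in>Ts. f \<tau> 0 = l}. \<Sum>b\<in>A. l a0 * (u b * (c \<tau> * f \<tau> 1 b * (\<Prod>j\<in>{2..<t}. \<Sum>a\<in>A. v a * f \<tau> j a))))"
      by (intro sum.cong refl) (simp add: sum_distrib_left sum_distrib_right mult_ac)
    also have "\<dots> = (\<Sum>b\<in>A. \<Sum>\<tau>\<in>{\<tau>\<in>Ts. f \<tau> 0 = l}. l a0 * (u b * (c \<tau> * f \<tau> 1 b * (\<Prod>j\<in>{2..<t}. \<Sum>a\<in>A. v a * f \<tau> j a))))"
      by (rule sum.swap)
    also have "\<dots> = l a0 * (\<Sum>b\<in>A. u b * G l b)"
      by (simp add: G_def sum_distrib_left)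
    finally show "(\<Sum>\<tau>\<in>{\<tau>\<in>{\<tau>\<in>Ts. f \<tau> 0 \<in> L}. f \<tau> 0 = l}. ?h \<tau>) = l a0 * (\<Sum>b\<in>A. u b * G l b)" .
  qed
  also have "\<dots> = 0" using uLG by (simp add: uB)
  finally show False using S1 by simp
qed

section \<open>Robust sums in a zero-sum-free set\<close>

lemma card_le_fibres:
  assumes "finite P" "finite G" "f ` P \<subseteq> G" "\<And>s. s \<in> G \<Longrightarrow> card {x\<in>P. f x = s} \<le> K"
  shows "card P \<le> K * card G"
proof -
  have "P = (\<Union>s\<in>G. {x\<in>P. f x = s})" using assms(3) by blast
  hence "card P \<le> (\<Sum>s\<in>G. card {x\<in>P. f x = s})"
    using card_UN_le[OF assms(2), of "\<lambda>s. {x\<in>P. f x = s}"] by simp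
  also have "\<dots> \<le> (\<Sum>s\<in>G. K)" by (intro sum_mono assms(4))
  finally show ?thesis by (simp add: mult.commute)
qed

section \<open>Robust sums and the pairs failing to have them\<close>

text \<open>The forbidden set \<open>H\<close> makes representations composable: a new one can be
  kept disjoint from the elements already used.\<close>

definition robust_sum :: "'g::comm_monoid_add set \<Rightarrow> nat \<Rightarrow> nat \<Rightarrow> 'g \<Rightarrow> bool" where
  "robust_sum A k N v \<longleftrightarrow> (\<forall>H. finite H \<and> card H \<le> N \<longrightarrow> (\<exists>S. S \<subseteq> A - H \<and> card S = k \<and> \<Sum>S = v))"

lemma robust_sumD:
  assumes "robust_sum A k N v" "finite H" "card H \<le> N"
  obtains S where "S \<subseteq> A - H" "card S = k" "\<Sum>S = v"
  using assms by (auto simp: robust_sum_def)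

definition weak_pairs :: "'g::comm_ring_1 set \<Rightarrow> nat \<Rightarrow> nat \<Rightarrow> nat \<Rightarrow> ('g \<times> 'g) set" where
  "weak_pairs A N j l =
     {(z, w) \<in> A \<times> A. \<not> robust_sum A (j + l) N (of_nat j * z + of_nat l * w)}"

text \<open>The ambient \<open>G\<close> will consist of all vectors supported on given coordinates.
  A ring is used so that multiples can be written \<open>of_nat j * z\<close>.\<close>

locale torsion_subset =
  fixes p :: nat and G A :: "'g::comm_ring_1 set"
  assumes prime_p: "prime p" and odd_p: "odd p" and torsion: "of_nat p = (0 :: 'g)"
    and finite_G: "finite G" and A_subset: "A \<subseteq> G"
    and zero_closed: "0 \<in> G"
    and add_closed: "\<And>x y. x \<in> G \<Longrightarrow> y \<in> G \<Longrightarrow> x + y \<in> G"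
begin

lemma finite_A: "finite A"
  using finite_G A_subset finite_subset by blast

lemma of_nat_mult_closed: "x \<in> G \<Longrightarrow> of_nat j * x \<in> G"
  by (induction j) (simp_all add: distrib_right zero_closed add_closed)

text \<open>An inverse \<open>m\<close> of \<open>l\<close> modulo \<open>p\<close> makes
  \<open>of_nat l\<close> a unit, since \<open>of_nat p = 0\<close>; the ring need not be a
  field.\<close>

lemma of_nat_mult_cancel:
  assumes "0 < l" "l < p" and eq: "of_nat l * x = of_nat l * (y :: 'g)"
  shows "x = y"
proof -
  have "coprime l p"
    using assms prime_p by (metis coprime_commute dvd_imp_le linorder_not_le prime_imp_coprime)
  then obtain m where "[l * m = Suc 0] (mod p)"
    using cong_solve_coprime_nat by blast
  hence "[1 = m * l] (mod p)" by (simp add: cong_sym mult.commute[of m])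
  then obtain q1 q2 where "m * l + q1 * p = 1 + q2 * p"
    by (metis cong_iff_lin_nat mult.commute)
  hence "of_nat (m * l + q1 * p) = (of_nat (1 + q2 * p) :: 'g)" by simp
  hence "of_nat m * of_nat l = (1 :: 'g)" by (simp add: torsion)
  thus ?thesis using eq by (metis mult.assoc mult_1)
qed

text \<open>A value \<open>s\<close> with more than \<open>2 * N + 1\<close> representations
  \<open>z + (s - z)\<close> has, for each \<open>H\<close> of size at most \<open>N\<close>, one
  that avoids \<open>H\<close> and has distinct summands. So no weak pair has such a sum.\<close>

lemma card_weak_pairs_1_1: "card (weak_pairs A N 1 1) \<le> (2 * N + 1) * card G"
proof (rule card_le_fibres[where f = "\<lambda>(z, w). z + w"])
  show "finite (weak_pairs A N 1 1)"
    by (rule finite_subset[of _ "A \<times> A"]) (auto simp: weak_pairs_def finite_A)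
  show "(\<lambda>(z, w). z + w) ` weak_pairs A N 1 1 \<subseteq> G"
    using A_subset by (auto simp: weak_pairs_def intro!: add_closed)
  fix s assume "s \<in> G"
  let ?F = "{x \<in> weak_pairs A N 1 1. (case x of (z, w) \<Rightarrow> z + w) = s}"
  define R where "R = {z\<in>A. s - z \<in> A}"
  have finR: "finite R" using finite_A by (simp add: R_def)
  show "card ?F \<le> 2 * N + 1"
  proof (rule ccontr)
    assume neg: "\<not> ?thesis"
    hence "?F \<noteq> {}" by (metis card.empty le0)
    hence ns: "\<not> robust_sum A 2 N s" by (auto simp: weak_pairs_def numeral_2_eq_2)
    have "?F \<subseteq> (\<lambda>z. (z, s - z)) ` R"
      by (auto simp: weak_pairs_def R_def image_iff)
    hence "card ?F \<le> card R"
      using finR by (meson card_image_le card_mono finite_imageI le_trans)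
    hence R: "card R > 2 * N + 1" using neg by simp
    from ns obtain H where H: "finite H" "card H \<le> N"
      and no: "\<nexists>S. S \<subseteq> A - H \<and> card S = 2 \<and> \<Sum>S = s" by (auto simp: robust_sum_def)
    \<comment> \<open>The degenerate case \<open>z = s - z\<close>. It excludes at most one
      \<open>z\<close>, because 2 is invertible modulo the odd \<open>p\<close>.\<close>
    define E where "E = {z. of_nat 2 * z = s}"
    have "p > 2" using prime_p odd_p prime_gt_1_nat[of p] by (cases "p = 2") auto
    hence "E \<subseteq> {z}" if "z \<in> E" for z
      using that of_nat_mult_cancel[of 2] by (auto simp: E_def)
    hence E: "finite E" "card E \<le> 1"
      by (metis equals0I finite.emptyI finite_insert finite_subset)
         (metis \<open>\<And>z. z \<in> E \<Longrightarrow> E \<subseteq> {z}\<close> card.empty card_mono equals0I finite.emptyI finite_insert is_singletonI is_singleton_altdef le_numeral_extra(4) zero_le_one)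
    have "card (H \<union> (\<lambda>h. s - h) ` H \<union> E) \<le> card H + card H + card E"
      using card_Un_le[of "H \<union> (\<lambda>h. s - h) ` H" E] card_Un_le[of H "(\<lambda>h. s - h) ` H"]
        card_image_le[OF H(1), of "\<lambda>h. s - h"] by linarith
    hence "card (H \<union> (\<lambda>h. s - h) ` H \<union> E) < card R" using H E R by linarith
    hence "\<not> R \<subseteq> H \<union> (\<lambda>h. s - h) ` H \<union> E"
      using H E by (meson card_mono finite_UnI finite_imageI linorder_not_le)
    then obtain z where z: "z \<in> R" "z \<notin> H" "z \<notin> (\<lambda>h. s - h) ` H" "z \<notin> E" by blast
    have "s - z \<notin> H" using z(3) by (auto simp: image_iff)
    moreover have "z \<noteq> s - z"
      using z(4) by (auto simp: E_def algebra_simps)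
    ultimately have "{z, s - z} \<subseteq> A - H \<and> card {z, s - z} = 2 \<and> \<Sum>{z, s - z} = s"
      using z by (auto simp: R_def)
    thus False using no by blast
  qed
qed (fact finite_G)

text \<open>If \<open>(j + 1) z + l w\<close> takes the value \<open>v\<close> on more than \<open>N\<close> pairs for which \<open>j z + l w\<close> is
  robust, then some such \<open>z\<close> avoids a given set of size \<open>N\<close>, and adjoining it to a representation
  of \<open>j z + l w\<close> represents \<open>v\<close>.\<close>
lemma card_weak_pairs_Suc:
  assumes l: "0 < l" "l < p"
  shows "card (weak_pairs A N (Suc j) l) \<le> card (weak_pairs A (Suc N) j l) + N * card G"
proof -
  let ?P = "weak_pairs A N (Suc j) l - weak_pairs A (Suc N) j l"
  let ?f = "\<lambda>(z, w). of_nat (Suc j) * z + of_nat l * w"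
  have fin: "finite (weak_pairs A N j l)" for N j
    by (rule finite_subset[of _ "A \<times> A"]) (auto simp: weak_pairs_def finite_A)
  have "card ?P \<le> N * card G"
  proof (rule card_le_fibres[where f = ?f])
    show "finite ?P" using fin by blast
    show "?f ` ?P \<subseteq> G"
      using A_subset by (auto simp: weak_pairs_def simp del: of_nat_Suc intro!: add_closed of_nat_mult_closed)
    fix v assume "v \<in> G"
    let ?F = "{x \<in> ?P. ?f x = v}"
    have finF: "finite ?F" using fin by simp
    have inj: "inj_on fst ?F"
    proof (rule inj_onI)
      fix x y assume "x \<in> ?F" "y \<in> ?F" "fst x = fst y"
      thus "x = y" using of_nat_mult_cancel[OF l] by (cases x; cases y) auto
    qed
    show "card ?F \<le> N"
    proof (rule ccontr)
      assume neg: "\<not> ?thesis"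
      hence "?F \<noteq> {}" by (metis card.empty le0)
      hence ns: "\<not> robust_sum A (Suc j + l) N v" by (auto simp: weak_pairs_def)
      then obtain H where H: "finite H" "card H \<le> N"
        and no: "\<nexists>S. S \<subseteq> A - H \<and> card S = Suc j + l \<and> \<Sum>S = v" by (auto simp: robust_sum_def)
      have "card H < card (fst ` ?F)" using neg H card_image[OF inj] by simp
      then obtain z where "z \<in> fst ` ?F" "z \<notin> H"
        using H by (meson card_mono linorder_not_le subsetI)
      then obtain w where zw: "(z, w) \<in> ?F" by force
      hence r: "robust_sum A (j + l) (Suc N) (of_nat j * z + of_nat l * w)" and zA: "z \<in> A"
        and v: "v = of_nat (Suc j) * z + of_nat l * w"
        by (auto simp: weak_pairs_def)
      have "finite (insert z H)" "card (insert z H) \<le> Suc N"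
        using H by (simp_all add: card_insert_if)
      from robust_sumD[OF r this] obtain S where S: "S \<subseteq> A - insert z H" "card S = j + l" "\<Sum>S = of_nat j * z + of_nat l * w" .
      have "finite S" "z \<notin> S" using S(1) finite_A finite_subset by blast+
      hence "insert z S \<subseteq> A - H \<and> card (insert z S) = Suc j + l \<and> \<Sum>(insert z S) = v"
        using S zA \<open>z \<notin> H\<close> by (subst sum.insert) (auto simp: v algebra_simps)
      thus False using no by blast
    qed
  qed (fact finite_G)
  moreover have "card (weak_pairs A N (Suc j) l) \<le> card (weak_pairs A (Suc N) j l \<union> ?P)"
    using fin by (intro card_mono) auto
  ultimately show ?thesis
    using card_Un_le[of "weak_pairs A (Suc N) j l" ?P] by linarith
qed

lemma card_weak_pairs_commute: "card (weak_pairs A N j l) = card (weak_pairs A N l j)"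
  by (rule bij_betw_same_card[of prod.swap], rule bij_betwI[where g = prod.swap])
     (auto simp: weak_pairs_def add.commute)

text \<open>The step from \<open>j\<close> to \<open>j + 1\<close> invokes the bound at
  \<open>N + 1\<close>, so \<open>N + j + l\<close> is preserved, and with it the second factor. The
  added \<open>N * card G\<close> is absorbed as the first factor grows by one.\<close>

lemma card_weak_pairs_aux:
  assumes l: "0 < l" "l < p"
    and base: "\<And>N. card (weak_pairs A N 1 l) \<le> (1 + l) * (2 * (N + 1 + l) + 1) * card G"
  shows "card (weak_pairs A N (Suc j) l) \<le> (Suc j + l) * (2 * (N + Suc j + l) + 1) * card G"
proof (induction j arbitrary: N)
  case 0
  show ?case using base by simp
next
  case (Suc j)
  have "card (weak_pairs A N (Suc (Suc j)) l)
      \<le> (Suc j + l) * (2 * (Suc N + Suc j + l) + 1) * card G + N * card G"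
    using card_weak_pairs_Suc[OF l, of N "Suc j"] Suc.IH[of "Suc N"] by linarith
  also have "\<dots> = ((Suc j + l) * (2 * (Suc N + Suc j + l) + 1) + N) * card G"
    by (simp only: distrib_right)
  also have "\<dots> \<le> ((Suc (Suc j) + l) * (2 * (N + Suc (Suc j) + l) + 1)) * card G"
    by (intro mult_right_mono) (auto simp: algebra_simps)
  finally show ?case .
qed

text \<open>Since the recursion raises the first coefficient only, it is run from
  \<open>(1, 1)\<close> to \<open>(l, 1)\<close>, the roles are swapped, and it is run again up to
  \<open>(j, l)\<close>.\<close>

lemma card_weak_pairs:
  assumes "0 < j" "0 < l" "l < p"
  shows "card (weak_pairs A N j l) \<le> (j + l) * (2 * (N + j + l) + 1) * card G"
proof -
  have "card (weak_pairs A N 1 1) \<le> (1 + 1) * (2 * (N + 1 + 1) + 1) * card G" for N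
    by (rule order.trans[OF card_weak_pairs_1_1]) (intro mult_right_mono, auto)
  hence "card (weak_pairs A N l 1) \<le> (l + 1) * (2 * (N + l + 1) + 1) * card G" for N
    using card_weak_pairs_aux[of 1 N "l - 1"] assms prime_gt_1_nat[OF prime_p] by simp
  hence "card (weak_pairs A N 1 l) \<le> (1 + l) * (2 * (N + 1 + l) + 1) * card G" for N
    by (subst card_weak_pairs_commute) (simp add: algebra_simps)
  thus ?thesis
    using card_weak_pairs_aux[of l N "j - 1"] assms by simp
qed

end

section \<open>Turan's bound for independent sets\<close>

text \<open>Greedy choice: keep a vertex of minimal degree, delete it with its neighbours, and
  recurse. As \<open>E\<close> is a symmetric relation, \<open>card E\<close> is twice the number of
  edges.\<close>

lemma ex_large_independent_set:
  assumes "finite A" "E \<subseteq> A \<times> A" "sym E" "irrefl E"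
  shows "\<exists>I\<subseteq>A. (\<forall>z\<in>I. \<forall>w\<in>I. (z, w) \<notin> E) \<and> (card A)\<^sup>2 \<le> card I * (card A + card E)"
  using assms
proof (induction "card A" arbitrary: A E rule: less_induct)
  case less
  show ?case
  proof (cases "A = {}")
    case False
    define deg where "deg z = card (E `` {z})" for z
    have finE: "finite E" using less.prems(1,2) finite_subset by blast
    have finN: "finite (E `` {z})" for z using finE by (rule finite_Image)
    obtain v where v: "v \<in> A" and minv: "\<And>z. z \<in> A \<Longrightarrow> deg v \<le> deg z"
      using arg_min_if_finite[OF less.prems(1) False, of deg] by (auto simp: not_less)
    define X where "X = insert v (E `` {v})"
    define x where "x = card X"
    have "v \<notin> E `` {v}" using less.prems(4) by (auto simp: irrefl_def)
    hence x: "x = Suc (deg v)" using finN by (simp add: x_def X_def deg_def)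
    have XA: "X \<subseteq> A" using less.prems(2) v by (auto simp: X_def)
    hence finX: "finite X" using less.prems(1) finite_subset by blast
    define A' where "A' = A - X"
    define E' where "E' = E \<inter> A' \<times> A'"
    have cA: "card A = card A' + x"
      using less.prems(1) finX XA card_mono[OF less.prems(1) XA]
      by (simp add: A'_def x_def card_Diff_subset)
    have "card A' < card A" using cA x by simp
    moreover have "finite A'" "E' \<subseteq> A' \<times> A'" "irrefl E'"
      using less.prems(1,4) by (auto simp: A'_def E'_def irrefl_def)
    moreover have "sym E'"
      using less.prems(3) by (intro symI) (auto simp: E'_def dest: symD)
    ultimately obtain I where I: "I \<subseteq> A'" "\<forall>z\<in>I. \<forall>w\<in>I. (z, w) \<notin> E'"
        and cI: "(card A')\<^sup>2 \<le> card I * (card A' + card E')"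
      using less.hyps[of A' E'] by blast
    \<comment> \<open>All \<open>x\<close> deleted vertices have degree at least
      \<open>deg v = x - 1\<close>, so at least \<open>x * (x - 1)\<close> ordered edges disappear
      with them.\<close>
    have "x * deg v \<le> (\<Sum>z\<in>X. deg z)"
      using sum_mono[of X "\<lambda>_. deg v" deg] minv XA by (auto simp: x_def)
    also have "\<dots> = card (SIGMA z:X. E `` {z})"
      using finX finN by (simp add: deg_def)
    finally have "x * deg v + card E' \<le> card (SIGMA z:X. E `` {z}) + card E'" by simp
    also have "\<dots> = card ((SIGMA z:X. E `` {z}) \<union> E')"
      using finE finX finN by (intro card_Un_disjoint[symmetric]) (auto simp: E'_def A'_def)
    also have "\<dots> \<le> card E"
      using finE by (intro card_mono) (auto simp: E'_def)
    finally have cE: "card A' + card E' + x\<^sup>2 \<le> card A + card E"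
      using cA x by (simp add: power2_eq_square)
    define J where "J = insert v I"
    have "v \<notin> I" using I(1) by (auto simp: A'_def X_def)
    moreover have "finite I" using I(1) \<open>finite A'\<close> finite_subset by blast
    ultimately have cJ: "card J = Suc (card I)" by (simp add: J_def)
    have Iv: "(v, z) \<notin> E" "(z, v) \<notin> E" if "z \<in> I" for z
      using that I(1) less.prems(3) by (auto simp: A'_def X_def dest: symD)
    have "(v, v) \<notin> E" using less.prems(4) by (simp add: irrefl_def)
    moreover have "(z, w) \<notin> E" if "z \<in> I" "w \<in> I" for z w
      using that I by (auto simp: E'_def)
    ultimately have "\<forall>z\<in>J. \<forall>w\<in>J. (z, w) \<notin> E"
      using Iv by (simp add: J_def)
    moreover have "(card A)\<^sup>2 \<le> card J * (card A + card E)"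
    proof -
      \<comment> \<open>What remains is that \<open>u\<^sup>2 \<le> i * s\<close> implies
        \<open>(u + x)\<^sup>2 \<le> (i + 1) * (s + x\<^sup>2)\<close>. The mixed term is controlled
        by the arithmetic-geometric mean inequality for \<open>i * x\<^sup>2\<close> and
        \<open>s\<close>.\<close>
      define u i s where "u = card A'" and "i = card I" and "s = card A' + card E'"
      have us: "u\<^sup>2 \<le> i * s" using cI by (simp add: u_def i_def s_def)
      have "(2 * u * x)\<^sup>2 = 4 * x\<^sup>2 * u\<^sup>2" by (simp add: power2_eq_square)
      also have "\<dots> \<le> 4 * x\<^sup>2 * (i * s)" using us by (intro mult_left_mono) auto
      also have "\<dots> \<le> (i * x\<^sup>2 + s)\<^sup>2"
      proof -
        have "0 \<le> (int i * (int x)\<^sup>2 - int s)\<^sup>2" by simp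
        also have "\<dots> = (int i * (int x)\<^sup>2 + int s)\<^sup>2 - 4 * (int x)\<^sup>2 * (int i * int s)"
          by (simp add: power2_diff power2_sum)
        finally have "int (4 * x\<^sup>2 * (i * s)) \<le> int ((i * x\<^sup>2 + s)\<^sup>2)" by simp
        thus ?thesis by (simp only: of_nat_le_iff)
      qed
      finally have "2 * u * x \<le> i * x\<^sup>2 + s" by (rule power2_le_imp_le) simp
      hence "(u + x)\<^sup>2 \<le> i * s + x\<^sup>2 + (i * x\<^sup>2 + s)"
        using us unfolding power2_sum by linarith
      also have "\<dots> = Suc i * (s + x\<^sup>2)" by (simp add: algebra_simps)
      finally have "(u + x)\<^sup>2 \<le> Suc i * (s + x\<^sup>2)" .
      also have "\<dots> \<le> Suc i * (card A + card E)"
        using cE by (intro mult_left_mono) (auto simp: s_def)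
      finally show ?thesis using cA cJ by (simp add: u_def i_def)
    qed
    moreover have "J \<subseteq> A" using I(1) v by (auto simp: J_def A'_def)
    ultimately show ?thesis by blast
  qed simp
qed

section \<open>Replacing a zero-sum tuple by distinct summands\<close>

context torsion_subset
begin

text \<open>The multiplicities of the elements of \<open>Z\<close> are removed two elements at a time: an element of
  multiplicity one is kept, otherwise all copies of one element are combined with a single copy of
  another one.\<close>
lemma ex_distinct_sum:
  assumes "finite Z" "card Z \<ge> 2" "finite H" "H \<inter> Z = {}"
    and "\<And>z. z \<in> Z \<Longrightarrow> a z > 0" "card H + sum a Z \<le> p" "Z \<subseteq> A"
    and "\<And>z w j l. z \<in> Z \<Longrightarrow> w \<in> Z \<Longrightarrow> z \<noteq> w \<Longrightarrow> 0 < j \<Longrightarrow> 0 < l \<Longrightarrow> j + l \<le> p \<Longrightarrow>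
           robust_sum A (j + l) p (of_nat j * z + of_nat l * w)"
  shows "\<exists>S\<subseteq>A - H. card S = sum a Z \<and> \<Sum>S = (\<Sum>z\<in>Z. of_nat (a z) * z)"
  using assms
proof (induction "card Z" arbitrary: Z H a rule: less_induct)
  case less
  note fin = \<open>finite Z\<close> and finH = \<open>finite H\<close> and pos = less.prems(5) and bnd = less.prems(6)
    and robust = less.prems(8)
  show ?case
  proof (cases "card Z = 2")
    case True
    then obtain z w where Z: "Z = {z, w}" "z \<noteq> w" by (auto simp: card_2_iff)
    have "robust_sum A (a z + a w) p (of_nat (a z) * z + of_nat (a w) * w)"
      using Z pos bnd by (intro robust) auto
    moreover have "card H \<le> p" using bnd by simp
    ultimately show ?thesis using Z finH by (simp add: robust_sum_def)
  next
    case False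
    hence c3: "card Z \<ge> 3" using less.prems(2) by simp
    show ?thesis
    proof (cases "\<exists>z\<in>Z. a z = 1")
      case True
      then obtain z where z: "z \<in> Z" "a z = 1" by blast
      have sumZ: "sum a Z = Suc (sum a (Z - {z}))"
        using fin z by (simp add: sum.remove[of Z z])
      have "\<exists>S\<subseteq>A - insert z H. card S = sum a (Z - {z}) \<and> \<Sum>S = (\<Sum>z\<in>Z - {z}. of_nat (a z) * z)"
      proof (rule less.hyps)
        show "card (insert z H) + sum a (Z - {z}) \<le> p"
          using bnd sumZ finH by (simp add: card_insert_if)
      qed (use c3 z fin finH less.prems in auto)
      then obtain S where S: "S \<subseteq> A - insert z H" "card S = sum a (Z - {z})"
        "\<Sum>S = (\<Sum>z\<in>Z - {z}. of_nat (a z) * z)" by blast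
      have "finite S" "z \<notin> S" using S(1) finite_A finite_subset by blast+
      moreover have "z \<in> A - H" using z less.prems by blast
      ultimately show ?thesis using S z fin sumZ
        by (intro exI[of _ "insert z S"]) (auto simp: sum.remove[of Z z])
    next
      case False
      hence a2: "a z \<ge> 2" if "z \<in> Z" for z
        using pos[OF that] that by (metis One_nat_def Suc_1 Suc_leI le_neq_implies_less)
      obtain z where z: "z \<in> Z" using c3 by fastforce
      have "card (Z - {z}) \<noteq> 0" using z c3 fin by simp
      then obtain w where w: "w \<in> Z - {z}" by (metis card.empty equals0I)
      \<comment> \<open>Only one copy of \<open>w\<close> is used up. All multiplicities are at
        least 2 here, so \<open>b\<close> stays positive on \<open>Z - {z}\<close> and the induction
        hypothesis applies.\<close>
      define b where "b = a(w := a w - 1)"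
      have bw: "a w = Suc (b w)" using pos[of w] w by (simp add: b_def)
      have sumb: "sum a (Z - {z}) = Suc (sum b (Z - {z}))"
        using fin w by (simp add: sum.remove[of "Z - {z}" w] bw) (simp add: b_def)
      have sumZ: "sum a Z = a z + 1 + sum b (Z - {z})"
        using fin z sumb by (simp add: sum.remove[of Z z])
      have "(\<Sum>z\<in>Z - {z}. of_nat (a z) * z) = w + (\<Sum>z\<in>Z - {z}. of_nat (b z) * z)"
        using fin w by (simp add: sum.remove[of "Z - {z}" w] bw distrib_right) (simp add: b_def)
      hence vec: "(\<Sum>z\<in>Z. of_nat (a z) * z) = (of_nat (a z) * z + of_nat 1 * w) + (\<Sum>z\<in>Z - {z}. of_nat (b z) * z)"
        using fin z by (simp add: sum.remove[of Z z])
      have "\<exists>S\<subseteq>A - H. card S = sum b (Z - {z}) \<and> \<Sum>S = (\<Sum>z\<in>Z - {z}. of_nat (b z) * z)"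
      proof (rule less.hyps)
        show "card H + sum b (Z - {z}) \<le> p" using bnd sumZ by simp
        show "b y > 0" if "y \<in> Z - {z}" for y
          using that a2[of y] pos[of y] by (auto simp: b_def)
      qed (use c3 z fin finH less.prems in auto)
      then obtain S where S: "S \<subseteq> A - H" "card S = sum b (Z - {z})"
        "\<Sum>S = (\<Sum>z\<in>Z - {z}. of_nat (b z) * z)" by blast
      have finS: "finite S" using S(1) finite_A finite_subset by blast
      \<comment> \<open>The combined block is chosen last, avoiding both \<open>H\<close> and the
        set \<open>S\<close> already built; their total size is at most \<open>p\<close>.\<close>
      have "robust_sum A (a z + 1) p (of_nat (a z) * z + of_nat 1 * w)"
        using z w pos bnd sumZ by (intro robust) auto
      moreover have "finite (H \<union> S)" using finH finS by simp
      moreover have "card (H \<union> S) \<le> p"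
        using card_Un_le[of H S] S(2) bnd sumZ by linarith
      ultimately obtain T where T: "T \<subseteq> A - (H \<union> S)" "card T = a z + 1"
          "\<Sum>T = of_nat (a z) * z + of_nat 1 * w"
        by (rule robust_sumD)
      have "finite T" using T(1) finite_A finite_subset by blast
      moreover have "T \<inter> S = {}" using T(1) by blast
      ultimately have "card (T \<union> S) = sum a Z" "\<Sum>(T \<union> S) = (\<Sum>z\<in>Z. of_nat (a z) * z)"
        using S T finS sumZ vec by (simp_all add: card_Un_disjoint sum.union_disjoint)
      thus ?thesis using S(1) T(1) by (intro exI[of _ "T \<union> S"]) blast
    qed
  qed
qed

text \<open>The tuple is recorded by its value set \<open>Z\<close> and the multiplicities
  \<open>a\<close>, which add up to \<open>p\<close>. Being non-constant, it has at least two
  values, as the regrouping requires.\<close>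

lemma ex_distinct_zero_sum:
  assumes B: "B \<subseteq> A"
    and robust: "\<And>z w j l. z \<in> B \<Longrightarrow> w \<in> B \<Longrightarrow> z \<noteq> w \<Longrightarrow> 0 < j \<Longrightarrow> 0 < l \<Longrightarrow> j + l \<le> p \<Longrightarrow>
           robust_sum A (j + l) p (of_nat j * z + of_nat l * w)"
    and x: "\<And>j. j < p \<Longrightarrow> x j \<in> B" "(\<Sum>j<p. x j) = 0" "\<not> (\<forall>j<p. x j = x 0)"
  shows "\<exists>S\<subseteq>A. card S = p \<and> \<Sum>S = 0"
proof -
  define Z where "Z = x ` {..<p}"
  define a where "a z = card {j\<in>{..<p}. x j = z}" for z
  have p: "p > 0" using prime_p prime_gt_0_nat by blast
  have sa: "sum a Z = p"
    using sum.group[of "{..<p}" Z x "\<lambda>_. 1 :: nat"] by (simp add: Z_def a_def)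
  have "(\<Sum>z\<in>Z. of_nat (a z) * z) = (\<Sum>z\<in>Z. \<Sum>j\<in>{j\<in>{..<p}. x j = z}. x j)"
    by (intro sum.cong refl) (simp add: a_def)
  also have "\<dots> = 0"
    using sum.group[of "{..<p}" Z x x] x(2) by (simp add: Z_def)
  finally have s0: "(\<Sum>z\<in>Z. of_nat (a z) * z) = 0" .
  obtain j where j: "j < p" "x j \<noteq> x 0" using x(3) by blast
  hence "card {x j, x 0} \<le> card Z" using p by (intro card_mono) (auto simp: Z_def)
  hence "card Z \<ge> 2" using j by simp
  moreover have "a z > 0" if "z \<in> Z" for z
    using that by (auto simp: Z_def a_def card_gt_0_iff)
  moreover have "Z \<subseteq> B" using x(1) by (auto simp: Z_def)
  ultimately have "\<exists>S\<subseteq>A - {}. card S = sum a Z \<and> \<Sum>S = (\<Sum>z\<in>Z. of_nat (a z) * z)"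
    using B by (intro ex_distinct_sum) (auto simp: sa intro!: robust, auto simp: Z_def)
  thus ?thesis using sa s0 by simp
qed

text \<open>An independent set of the graph of weak pairs contains no non-constant zero-sum
  \<open>p\<close>-tuple, as it could be regrouped into \<open>p\<close> distinct elements of
  \<open>A\<close>. So \<open>M\<close> bounds its size, and Turan's bound turns this into a bound
  for \<open>A\<close>.\<close>

lemma card_square_le:
  assumes no: "\<nexists>S. S \<subseteq> A \<and> card S = p \<and> \<Sum>S = 0"
    and M: "\<And>B. B \<subseteq> A \<Longrightarrow> (\<And>x. (\<And>j. j < p \<Longrightarrow> x j \<in> B) \<Longrightarrow> (\<Sum>j<p. x j) = 0 \<Longrightarrow> \<forall>j<p. x j = x 0)
             \<Longrightarrow> card B \<le> M"
  shows "(card A)\<^sup>2 \<le> M * ((1 + p ^ 3 * (4 * p + 1)) * card G)"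
proof -
  define W where "W = (\<Union>(j, l)\<in>{1..<p} \<times> {1..<p}. if j + l \<le> p then weak_pairs A p j l else {})"
  define E where "E = W - Id"
  have "W \<subseteq> A \<times> A" by (auto simp: W_def weak_pairs_def split: if_splits)
  hence finE: "finite W" "E \<subseteq> A \<times> A"
    using finite_subset[OF _ finite_cartesian_product[OF finite_A finite_A]] by (auto simp: E_def)
  have "card W \<le> (\<Sum>(j, l)\<in>{1..<p} \<times> {1..<p}. card (if j + l \<le> p then weak_pairs A p j l else {}))"
    unfolding W_def by (rule order.trans[OF card_UN_le]) (auto simp: case_prod_unfold)
  \<comment> \<open>With \<open>N = p\<close> and \<open>j + l \<le> p\<close>, each coefficient
    pair gives at most \<open>p * (4 * p + 1) * card G\<close> weak pairs.\<close>
  also have "\<dots> \<le> (\<Sum>(j, l)\<in>{1..<p} \<times> {1..<p}. p * (4 * p + 1) * card G)"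
  proof (intro sum_mono, clarify)
    fix j l assume jl: "j \<in> {1..<p}" "l \<in> {1..<p}"
    have "card (weak_pairs A p j l) \<le> p * (4 * p + 1) * card G" if "j + l \<le> p"
    proof -
      have "card (weak_pairs A p j l) \<le> (j + l) * (2 * (p + j + l) + 1) * card G"
        using jl by (intro card_weak_pairs) auto
      also have "\<dots> \<le> p * (4 * p + 1) * card G"
        using that by (intro mult_mono) auto
      finally show ?thesis .
    qed
    thus "card (if j + l \<le> p then weak_pairs A p j l else {}) \<le> p * (4 * p + 1) * card G" by simp
  qed
  also have "\<dots> = (p - 1) * (p - 1) * (p * (4 * p + 1) * card G)"
    by (simp add: card_cartesian_product)
  also have "\<dots> \<le> p * p * (p * (4 * p + 1) * card G)"
    by (intro mult_mono) auto
  finally have cE: "card E \<le> p ^ 3 * (4 * p + 1) * card G"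
    using card_mono[OF finE(1), of E] by (auto simp: E_def power3_eq_cube algebra_simps)
  have weak_sym: "(w, z) \<in> weak_pairs A p l j \<longleftrightarrow> (z, w) \<in> weak_pairs A p j l" for z w j l
    by (auto simp: weak_pairs_def add.commute)
  have "sym E"
  proof (rule symI)
    fix z w assume "(z, w) \<in> E"
    then obtain j l where "j \<in> {1..<p}" "l \<in> {1..<p}" "j + l \<le> p" "(z, w) \<in> weak_pairs A p j l" "z \<noteq> w"
      by (auto simp: E_def W_def split: if_splits)
    hence "(w, z) \<in> W"
      unfolding W_def by (intro UN_I[of "(l, j)"]) (auto simp: weak_sym add.commute)
    thus "(w, z) \<in> E" using \<open>z \<noteq> w\<close> by (simp add: E_def)
  qed
  moreover have "irrefl E" by (auto simp: E_def irrefl_def)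
  ultimately obtain I where I: "I \<subseteq> A" "\<forall>z\<in>I. \<forall>w\<in>I. (z, w) \<notin> E"
    and cI: "(card A)\<^sup>2 \<le> card I * (card A + card E)"
    using ex_large_independent_set[OF finite_A finE(2)] by blast
  have "card I \<le> M"
  proof (rule M[OF I(1)], rule ccontr)
    fix x assume x: "\<And>j. j < p \<Longrightarrow> x j \<in> I" "(\<Sum>j<p. x j) = 0" "\<not> (\<forall>j<p. x j = x 0)"
    have "robust_sum A (j + l) p (of_nat j * z + of_nat l * w)"
      if zw: "z \<in> I" "w \<in> I" "z \<noteq> w" and jl: "0 < j" "0 < l" "j + l \<le> p" for z w j l
    proof (rule ccontr)
      assume "\<not> ?thesis"
      hence "(z, w) \<in> weak_pairs A p j l" using zw I(1) by (auto simp: weak_pairs_def)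
      hence "(z, w) \<in> W" using jl unfolding W_def by (intro UN_I[of "(j, l)"]) auto
      hence "(z, w) \<in> E" using zw(3) by (simp add: E_def)
      thus False using I(2) zw by blast
    qed
    thus False using ex_distinct_zero_sum[OF I(1) _ x] no by blast
  qed
  moreover have "card A + card E \<le> (1 + p ^ 3 * (4 * p + 1)) * card G"
    using cE card_mono[OF finite_G A_subset] by (simp add: algebra_simps)
  ultimately show ?thesis
    using cI by (meson le_trans mult_le_mono)
qed

end

section \<open>The indicator of a vanishing sum\<close>

lemma sum_fun_apply: "(\<Sum>i\<in>A. f i) x = (\<Sum>i\<in>A. f i x)"
  by (induction A rule: infinite_finite_induct) simp_all

text \<open>Multiplication by \<open>x\<close> permutes the nonzero elements, so it preserves their
  product.\<close>

lemma finite_field_power_minus_1: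
  fixes x :: "'a::{finite,field}"
  assumes "x \<noteq> 0"
  shows "x ^ (CARD('a) - 1) = 1"
proof -
  have "(\<Prod>y\<in>UNIV-{0}. x * y) = (\<Prod>y\<in>UNIV-{0}. y)"
    by (rule prod.reindex_bij_witness[of _ "\<lambda>y. y / x" "\<lambda>y. x * y"]) (use assms in auto)
  moreover have "(\<Prod>y\<in>UNIV-{0}. x * y) = x ^ (CARD('a) - 1) * \<Prod>(UNIV-{0})"
    by (simp add: prod.distrib)
  moreover have "\<Prod>(UNIV-{0::'a}) \<noteq> 0" by simp
  ultimately show ?thesis by simp
qed

lemma prime_CHAR_finite_field: "prime CHAR('a::{finite,field})"
  by (rule prime_CHAR_semidom) (simp add: finite_imp_CHAR_pos)

lemma CHAR_eqI:
  assumes "prime p" "of_nat p = (0 :: 'a::{finite,field})"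
  shows "CHAR('a) = p"
  using assms prime_CHAR_finite_field[where 'a = 'a]
  by (metis of_nat_eq_0_iff_char_dvd primes_dvd_imp_eq)

lemma CHAR_eq_of_CARD:
  assumes "prime p" "CARD('a::{finite,field}) = p ^ k"
  shows "CHAR('a) = p"
  using CHAR_dvd_CARD[where 'a = 'a] assms prime_CHAR_finite_field[where 'a = 'a]
  by (metis prime_dvd_power primes_dvd_imp_eq)

text \<open>Otherwise no additive subgroup of order a power of the characteristic is the whole
  field, so such subgroups can be enlarged forever, which finiteness forbids.\<close>

lemma CARD_eq_power_CHAR: "\<exists>j. CARD('a::{finite,field}) = CHAR('a) ^ j"
proof (rule ccontr)
  let ?p = "CHAR('a)"
  note pr = prime_CHAR_finite_field[where 'a = 'a]
  assume neg: "\<not> ?thesis"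
  have "\<exists>H::'a set. 0 \<in> H \<and> (\<forall>x\<in>H. \<forall>y\<in>H. x + y \<in> H) \<and> card H = ?p ^ i" for i
  proof (induction i)
    case 0
    show ?case by (intro exI[of _ "{0}"]) simp
  next
    case (Suc i)
    then obtain H :: "'a set" where H0: "0 \<in> H" and Hadd: "\<And>x y. x \<in> H \<Longrightarrow> y \<in> H \<Longrightarrow> x + y \<in> H"
      and cH: "card H = ?p ^ i" by blast
    have "H \<noteq> UNIV" using cH neg by auto
    then obtain x where x: "x \<notin> H" by blast
    have Hmult: "of_nat j * y \<in> H" if "y \<in> H" for j y
      by (induction j) (use that in \<open>simp_all add: distrib_right H0 Hadd\<close>)
    \<comment> \<open>Negation is multiplication by \<open>?p - 1\<close>, so closure under addition
      suffices as the invariant.\<close>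
    have Huminus: "- y \<in> H" if "y \<in> H" for y
    proof -
      have "of_nat (?p - 1) * y = - y"
        using prime_gt_0_nat[OF pr] by (simp add: of_nat_diff)
      thus ?thesis using Hmult[OF that] by metis
    qed
    \<comment> \<open>The subgroup generated by \<open>H\<close> and \<open>x\<close>. No multiple
      of \<open>x\<close> with factor strictly between 0 and \<open>?p\<close> lies in
      \<open>H\<close>, so it is \<open>?p\<close> times as large.\<close>
    define K where "K = (\<lambda>(j, y). of_nat j * x + y) ` ({..<?p} \<times> H)"
    have nx: "of_nat j * x \<notin> H" if j: "0 < j" "j < ?p" for j
    proof
      assume mem: "of_nat j * x \<in> H"
      have "coprime j ?p"
        using j pr by (metis coprime_commute dvd_imp_le linorder_not_le prime_imp_coprime)
      then obtain m where "[j * m = Suc 0] (mod ?p)"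
        using cong_solve_coprime_nat by blast
      hence "of_nat (j * m) = (of_nat (Suc 0) :: 'a)"
        by (simp only: of_nat_eq_iff_cong_CHAR)
      hence "of_nat m * (of_nat j * x) = x"
        by (simp add: mult.commute mult.left_commute)
      thus False using Hmult[OF mem] x by metis
    qed
    have "inj_on (\<lambda>(j, y). of_nat j * x + y) ({..<?p} \<times> H)"
    proof -
      have "j = j' \<and> y = y'"
        if "of_nat j * x + y = of_nat j' * x + y'" "j \<le> j'" "j' < ?p" "y \<in> H" "y' \<in> H" for j j' y y'
      proof -
        have "of_nat (j' - j) * x = y + - y'"
          using that by (simp add: of_nat_diff algebra_simps)
        hence "of_nat (j' - j) * x \<in> H" using Hadd Huminus that by metis
        hence "j' - j = 0" using nx[of "j' - j"] that by fastforce
        thus ?thesis using that by simp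
      qed
      thus ?thesis unfolding inj_on_def by (auto, (metis nat_le_linear)+)
    qed
    hence "card K = ?p ^ Suc i"
      using cH by (simp add: K_def card_image card_cartesian_product)
    moreover have "0 \<in> K"
      using H0 prime_gt_0_nat[OF pr] unfolding K_def by (intro image_eqI[of _ _ "(0, 0)"]) auto
    moreover have "a + b \<in> K" if "a \<in> K" "b \<in> K" for a b
    proof -
      have "\<exists>j y. a = of_nat j * x + y \<and> y \<in> H" if a: "a \<in> K" for a
      proof -
        obtain r where "a = of_nat (fst r) * x + snd r" "snd r \<in> H"
          using a by (auto simp: K_def)
        thus ?thesis by blast
      qed
      then obtain j y j' y' where e: "a = of_nat j * x + y" "b = of_nat j' * x + y'" "y \<in> H" "y' \<in> H"
        using \<open>a \<in> K\<close> \<open>b \<in> K\<close> by metis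
      have "of_nat ((j + j') mod ?p) = (of_nat (j + j') :: 'a)"
        by (simp only: of_nat_eq_iff_cong_CHAR) (simp add: cong_def)
      hence "a + b = of_nat ((j + j') mod ?p) * x + (y + y')"
        by (simp add: e algebra_simps)
      moreover have "((j + j') mod ?p, y + y') \<in> {..<?p} \<times> H"
        using Hadd e prime_gt_0_nat[OF pr] by auto
      ultimately show ?thesis unfolding K_def by (metis (mono_tags, lifting) case_prod_conv image_eqI)
    qed
    ultimately show ?case by blast
  qed
  then obtain H :: "'a set" where "card H = ?p ^ CARD('a)" by blast
  moreover have "card H \<le> CARD('a)" by (intro card_mono) auto
  moreover have "CARD('a) < ?p ^ CARD('a)"
    using prime_gt_1_nat[OF pr] by (intro power_gt_expt) simp
  ultimately show False by simp
qed

section \<open>The indicator polynomial and its monomials of low degree\<close>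

text \<open>The inequality bounds the degree by a \<open>p\<close>-th part of the maximal degree
  \<open>(p - 1) * card I\<close>: when \<open>p\<close> monomials share that degree, one of them
  satisfies it.\<close>

definition low_exponents :: "'i set \<Rightarrow> nat \<Rightarrow> ('i \<Rightarrow> nat) set" where
  "low_exponents I p = {e \<in> I \<rightarrow>\<^sub>E {..<p}. p * sum e I \<le> (p - 1) * card I}"

lemma finite_low_exponents: "finite I \<Longrightarrow> finite (low_exponents I p)"
  unfolding low_exponents_def by (rule finite_subset[of _ "I \<rightarrow>\<^sub>E {..<p}"]) (auto simp: finite_PiE)

text \<open>On \<open>\<F>\<^sub>q\<close> with \<open>q = p ^ k\<close> the conjugates \<open>x ^ p ^ i\<close>, \<open>i < k\<close>, are additive and play the role of
  coordinates over \<open>\<F>\<^sub>p\<close>: the factorisation \<open>x ^ (q - 1) = (\<Prod>i<k. (x ^ p ^ i) ^ (p - 1))\<close> has degree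
  \<open>k (p - 1)\<close> in them.\<close>
lemma power_card_minus_1_conjugates:
  fixes x :: "'a::{finite,field}"
  assumes "CARD('a) = p ^ k" "p > 0"
  shows "(\<Prod>i<k. (x ^ p ^ i) ^ (p - 1)) = x ^ (CARD('a) - 1)"
proof -
  have "(\<Prod>i<k. (x ^ p ^ i) ^ (p - 1)) = x ^ (\<Sum>i<k. p ^ i * (p - 1))"
    by (simp add: power_sum power_mult)
  also have "(\<Sum>i<k. p ^ i * (p - 1)) = p ^ k - 1"
  proof (induction k)
    case (Suc k)
    have "p ^ k \<ge> 1" using assms(2) by simp
    thus ?case using Suc assms(2) by (cases p) (auto simp: mult.commute)
  qed simp
  finally show ?thesis using assms by simp
qed

text \<open>By Fermat, \<open>1 - x c ^ (q - 1)\<close> with \<open>q = CARD('a)\<close> is the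
  indicator of \<open>x c = 0\<close>. The left side is the product of these factors over
  \<open>C\<close>, expanded over subsets \<open>U\<close>.\<close>

lemma zero_indicator:
  fixes x :: "'c \<Rightarrow> 'a::{finite,field}"
  assumes "finite C" "CARD('a) = p ^ k" "p > 0"
  shows "(\<Sum>U\<in>Pow C. (-1) ^ card U * (\<Prod>(c, i)\<in>U \<times> {..<k}. (x c ^ p ^ i) ^ (p - 1)))
       = (if \<forall>c\<in>C. x c = 0 then 1 else 0)"
proof -
  have "CARD('a) > 1" using card_mono[of UNIV "{0, 1 :: 'a}"] by simp
  hence "(1 - x c ^ (CARD('a) - 1)) = of_bool (x c = 0)" for c
    using finite_field_power_minus_1[of "x c"] by (auto simp: zero_power)
  hence "(if \<forall>c\<in>C. x c = 0 then 1 else 0) = (\<Prod>c\<in>C. (- (x c ^ (CARD('a) - 1))) + 1)"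
    using assms(1) by (auto simp: of_bool_def intro: prod_zero)
  also have "\<dots> = (\<Sum>U\<in>Pow C. (\<Prod>c\<in>U. - (x c ^ (CARD('a) - 1))))"
    by (subst prod_add[OF assms(1)]) simp
  also have "\<dots> = (\<Sum>U\<in>Pow C. (-1) ^ card U * (\<Prod>(c, i)\<in>U \<times> {..<k}. (x c ^ p ^ i) ^ (p - 1)))"
    by (simp only: prod_uminus power_card_minus_1_conjugates[OF assms(2,3), symmetric] prod.cartesian_product)
  finally show ?thesis ..
qed

text \<open>Multiplied out, the indicator of \<open>\<Sum>j<p. x j = 0\<close> is a combination of products of \<open>p\<close> monomials, the
  \<open>j\<close>-th in the conjugates of the coordinates of \<open>x j\<close>, whose degrees add up to at most
  \<open>(p - 1) k \<bar>C\<bar>\<close>; so one of them has low degree.\<close>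
lemma card_zero_sum_free_le:
  fixes A :: "('c \<Rightarrow> 'a::{finite,field}) set"
  assumes A: "finite A" and C: "finite C" and p: "prime p" and q: "CARD('a) = p ^ k"
    and supp: "\<And>x c. x \<in> A \<Longrightarrow> c \<notin> C \<Longrightarrow> x c = 0"
    and const: "\<And>x. (\<And>j. j < p \<Longrightarrow> x j \<in> A) \<Longrightarrow> (\<Sum>j<p. x j) = 0 \<Longrightarrow> \<forall>j<p. x j = x 0"
  shows "card A \<le> 3 * card (low_exponents (C \<times> {..<k}) p)"
proof -
  let ?I = "C \<times> {..<k}"
  have char: "CHAR('a) = p" by (rule CHAR_eq_of_CARD[OF p q])
  have p2: "p \<ge> 2" using p prime_ge_2_nat by blast
  hence p_ne: "{..<p} \<noteq> {}" by (auto simp: set_eq_iff intro: exI[of _ 0])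
  define y where "y = (\<lambda>(c, i) (x :: 'c \<Rightarrow> 'a). x c ^ p ^ i)"
  have y_add: "y r (\<Sum>j<p. x j) = (\<Sum>j<p. y r (x j))" for r x
    using freshmans_dream_sum'[of "p ^ snd r" "snd r" "\<lambda>j. x j (fst r)" "{..<p}"] p char
    by (simp add: y_def case_prod_unfold sum_fun_apply)
  define mono where "mono e x = (\<Prod>r\<in>?I. y r x ^ e r)" for e x
  \<comment> \<open>A slot is one additive factor of the term of \<open>U\<close>: a conjugate
    coordinate together with one of its \<open>p - 1\<close> copies. Expanding the product,
    \<open>\<phi>\<close> assigns to each slot the index \<open>j\<close> of the chosen summand, and
    \<open>ex\<close> counts the resulting exponents.\<close>
  define slots where "slots U = (U \<times> {..<k}) \<times> {..<p - 1}" for U :: "'c set"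
  define Ts where "Ts = (SIGMA U:Pow C. slots U \<rightarrow>\<^sub>E {..<p})"
  define f where "f = (\<lambda>(U, \<phi>) (j :: nat) x. \<Prod>s\<in>{s\<in>slots U. \<phi> s = j}. y (fst s) x)"
  define ex where "ex = (\<lambda>(U, \<phi>) j. \<lambda>r\<in>?I. card {s\<in>slots U. \<phi> s = (j::nat) \<and> fst s = r})"
  have fin_slots: "finite (slots U)" if "U \<subseteq> C" for U
    using that C by (auto simp: slots_def intro: finite_subset)
  have sub_slots: "fst s \<in> ?I" if "s \<in> slots U" "U \<subseteq> C" for s U
    using that by (auto simp: slots_def)
  have f_eq: "f (U, \<phi>) j = mono (ex (U, \<phi>) j)" if "U \<subseteq> C" for U j and \<phi> :: "_ \<Rightarrow> nat"
  proof
    fix x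
    have "f (U, \<phi>) j x = (\<Prod>r\<in>?I. \<Prod>s\<in>{s\<in>{s\<in>slots U. \<phi> s = j}. fst s = r}. y (fst s) x)"
      unfolding f_def using fin_slots[OF that] sub_slots[OF _ that] C
      by (subst prod.group) auto
    also have "\<dots> = mono (ex (U, \<phi>) j) x"
      unfolding mono_def ex_def by (intro prod.cong refl) (auto simp: conj_assoc)
    finally show "f (U, \<phi>) j x = mono (ex (U, \<phi>) j) x" .
  qed
  have finL: "finite (low_exponents ?I p)" using C by (simp add: finite_low_exponents)
  have "card A \<le> 3 * card (mono ` low_exponents ?I p)"
  proof (rule diagonal_slice_bound[where f = f and Ts = Ts and c = "\<lambda>(U, \<phi>). (-1) ^ card U" and t = p])
    show "finite Ts" using C fin_slots by (auto simp: Ts_def intro!: finite_SigmaI finite_PiE)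
    fix x :: "nat \<Rightarrow> 'c \<Rightarrow> 'a" assume x: "\<And>j. j < p \<Longrightarrow> x j \<in> A"
    have "(\<Sum>\<tau>\<in>Ts. (case \<tau> of (U, \<phi>) \<Rightarrow> (-1) ^ card U) * (\<Prod>j<p. f \<tau> j (x j)))
        = (\<Sum>U\<in>Pow C. \<Sum>\<phi>\<in>slots U \<rightarrow>\<^sub>E {..<p}. (-1) ^ card U * (\<Prod>j<p. f (U, \<phi>) j (x j)))"
      unfolding Ts_def using C fin_slots by (subst sum.Sigma) (auto simp: case_prod_unfold intro!: finite_PiE)
    also have "\<dots> = (\<Sum>U\<in>Pow C. (-1) ^ card U * (\<Prod>(c, i)\<in>U \<times> {..<k}. ((\<Sum>j<p. x j) c ^ p ^ i) ^ (p - 1)))"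
    proof (intro sum.cong refl)
      fix U assume U: "U \<in> Pow C"
      have "(\<Sum>\<phi>\<in>slots U \<rightarrow>\<^sub>E {..<p}. \<Prod>j<p. f (U, \<phi>) j (x j)) = (\<Sum>\<phi>\<in>slots U \<rightarrow>\<^sub>E {..<p}. \<Prod>s\<in>slots U. y (fst s) (x (\<phi> s)))"
      proof (intro sum.cong refl)
        fix \<phi> assume \<phi>: "\<phi> \<in> slots U \<rightarrow>\<^sub>E {..<p}"
        have "(\<Prod>j<p. f (U, \<phi>) j (x j)) = (\<Prod>j<p. \<Prod>s\<in>{s\<in>slots U. \<phi> s = j}. y (fst s) (x (\<phi> s)))"
          unfolding f_def by (intro prod.cong refl) auto
        also have "\<dots> = (\<Prod>s\<in>slots U. y (fst s) (x (\<phi> s)))"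
          using \<phi> U fin_slots by (intro prod.group) auto
        finally show "(\<Prod>j<p. f (U, \<phi>) j (x j)) = (\<Prod>s\<in>slots U. y (fst s) (x (\<phi> s)))" .
      qed
      also have "\<dots> = (\<Prod>s\<in>slots U. \<Sum>j<p. y (fst s) (x j))"
        using U fin_slots by (subst prod_sum_PiE) auto
      also have "\<dots> = (\<Prod>s\<in>slots U. y (fst s) (\<Sum>j<p. x j))"
        by (simp add: y_add)
      also have "\<dots> = (\<Prod>r\<in>U \<times> {..<k}. y r (\<Sum>j<p. x j) ^ (p - 1))"
        unfolding slots_def by (simp add: prod.cartesian_product' del: prod.cartesian_product)
      finally show "(\<Sum>\<phi>\<in>slots U \<rightarrow>\<^sub>E {..<p}. (-1) ^ card U * (\<Prod>j<p. f (U, \<phi>) j (x j)))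
          = (-1) ^ card U * (\<Prod>(c, i)\<in>U \<times> {..<k}. ((\<Sum>j<p. x j) c ^ p ^ i) ^ (p - 1))"
        by (simp add: sum_distrib_left[symmetric] y_def case_prod_unfold)
    qed
    also have "\<dots> = (if \<forall>c\<in>C. (\<Sum>j<p. x j) c = 0 then 1 else 0)"
      using p2 by (intro zero_indicator C q) auto
    also have "(\<forall>c\<in>C. (\<Sum>j<p. x j) c = 0) \<longleftrightarrow> (\<Sum>j<p. x j) = 0"
    proof
      assume zero: "\<forall>c\<in>C. (\<Sum>j<p. x j) c = 0"
      show "(\<Sum>j<p. x j) = 0"
      proof
        fix c
        have "(\<Sum>j<p. x j) c = 0" if "c \<notin> C"
          unfolding sum_fun_apply by (intro sum.neutral ballI supp[OF x that]) simp
        thus "(\<Sum>j<p. x j) c = 0 c" using zero by (cases "c \<in> C") auto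
      qed
    qed simp
    also have "\<dots> \<longleftrightarrow> (\<forall>j<p. x j = x 0)"
    proof
      assume same: "\<forall>j<p. x j = x 0"
      show "(\<Sum>j<p. x j) = 0"
      proof
        fix c
        have "(\<Sum>j<p. x j) c = (\<Sum>j<p. x 0 c)"
          unfolding sum_fun_apply by (rule sum.cong[OF refl], subst same[rule_format]) simp_all
        also have "\<dots> = of_nat CHAR('a) * x 0 c" by (simp add: char)
        finally show "(\<Sum>j<p. x j) c = 0 c" by simp
      qed
    next
      assume "(\<Sum>j<p. x j) = 0"
      thus "\<forall>j<p. x j = x 0" using const[of x] x by blast
    qed
    finally show "(\<Sum>\<tau>\<in>Ts. (case \<tau> of (U, \<phi>) \<Rightarrow> (-1) ^ card U) * (\<Prod>j<p. f \<tau> j (x j)))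
        = (if \<forall>j<p. x j = x 0 then 1 else 0)" .
  next
    fix \<tau> assume "\<tau> \<in> Ts"
    then obtain U \<phi> where \<tau>: "\<tau> = (U, \<phi>)" "U \<subseteq> C" "\<phi> \<in> slots U \<rightarrow>\<^sub>E {..<p}"
      by (auto simp: Ts_def)
    note fs = fin_slots[OF \<tau>(2)]
    have deg: "sum (ex \<tau> j) ?I = card {s\<in>slots U. \<phi> s = j}" for j
    proof -
      have "card {s\<in>slots U. \<phi> s = j} = (\<Sum>r\<in>?I. \<Sum>s\<in>{s\<in>{s\<in>slots U. \<phi> s = j}. fst s = r}. 1)"
        using fs sub_slots[OF _ \<tau>(2)] C by (subst sum.group) auto
      thus ?thesis by (simp add: \<tau> ex_def conj_assoc)
    qed
    have total: "(\<Sum>j<p. card {s\<in>slots U. \<phi> s = j}) = card (slots U)"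
      using fs \<tau>(3) sum.group[of "slots U" "{..<p}" \<phi> "\<lambda>_. 1 :: nat"] by auto
    have "card (slots U) \<le> (p - 1) * card ?I"
      using card_mono[OF C \<tau>(2)] by (simp add: slots_def card_cartesian_product mult_ac)
    have "\<exists>j<p. p * sum (ex \<tau> j) ?I \<le> (p - 1) * card ?I"
    proof (rule ccontr)
      assume "\<not> ?thesis"
      hence "(\<Sum>j<p. (p - 1) * card ?I) < (\<Sum>j<p. p * sum (ex \<tau> j) ?I)"
        using p_ne by (intro sum_strict_mono) auto
      also have "\<dots> = p * card (slots U)"
        by (simp add: deg total sum_distrib_left[symmetric])
      finally have "(p - 1) * card ?I < card (slots U)" using p2 by simp
      thus False using \<open>card (slots U) \<le> (p - 1) * card ?I\<close> by simp
    qed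
    then obtain j where j: "j < p" "p * sum (ex \<tau> j) ?I \<le> (p - 1) * card ?I" by blast
    have "ex \<tau> j r < p" if "r \<in> ?I" for r
    proof -
      have "card {s\<in>slots U. \<phi> s = j \<and> fst s = r} \<le> card ({r} \<times> {..<p - 1})"
        by (intro card_mono) (auto simp: slots_def)
      thus ?thesis using that p2 by (simp add: \<tau> ex_def card_cartesian_product)
    qed
    moreover have "ex \<tau> j r = undefined" if "r \<notin> ?I" for r
      using that unfolding \<tau>(1) ex_def prod.case by (simp only: restrict_def if_False)
    ultimately have "ex \<tau> j \<in> ?I \<rightarrow>\<^sub>E {..<p}" by (intro PiE_I) simp_all
    hence "ex \<tau> j \<in> low_exponents ?I p"
      using j(2) unfolding low_exponents_def by blast
    hence "f \<tau> j \<in> mono ` low_exponents ?I p"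
      unfolding \<tau>(1) f_eq[OF \<tau>(2)] by (rule imageI)
    thus "\<exists>j<p. f \<tau> j \<in> mono ` low_exponents ?I p"
      using j(1) by blast
  qed (use A finL p2 in simp_all)
  also have "\<dots> \<le> 3 * card (low_exponents ?I p)"
    using finL by (intro mult_left_mono card_image_le) auto
  finally show ?thesis .
qed

section \<open>The constant EGZ\<close>

text \<open>A Chernoff-type bound: vectors are weighted by \<open>\<gamma>\<close> to the degree.
  Low ones weigh at least \<open>b ^ card I\<close>, and the total weight of all vectors factors
  over the coordinates.\<close>

lemma card_low_exponents_mult_le:
  fixes b \<gamma> :: real
  assumes I: "finite I" and \<gamma>: "0 \<le> \<gamma>"
    and b: "\<And>e. e \<in> low_exponents I p \<Longrightarrow> b ^ card I \<le> \<gamma> ^ sum e I"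
  shows "real (card (low_exponents I p)) * b ^ card I \<le> (\<Sum>e<p. \<gamma> ^ e) ^ card I"
proof -
  have "real (card (low_exponents I p)) * b ^ card I \<le> (\<Sum>e\<in>low_exponents I p. \<gamma> ^ sum e I)"
    using sum_mono[OF b, of "low_exponents I p"] by simp
  also have "\<dots> \<le> (\<Sum>e\<in>I \<rightarrow>\<^sub>E {..<p}. \<gamma> ^ sum e I)"
    using I \<gamma> by (intro sum_mono2) (auto simp: low_exponents_def finite_PiE)
  also have "\<dots> = (\<Sum>e\<in>I \<rightarrow>\<^sub>E {..<p}. \<Prod>i\<in>I. \<gamma> ^ e i)"
    by (simp add: power_sum)
  also have "\<dots> = (\<Sum>e<p. \<gamma> ^ e) ^ card I"
    using I by (subst prod_sum_PiE[symmetric]) auto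
  finally show ?thesis .
qed

text \<open>Here \<open>\<gamma> = b = 1/2\<close>: the degree is at most \<open>card I\<close> and
  the geometric sum at most 2, which gives \<open>2 / (1/2) = 4\<close> per coordinate.\<close>

lemma card_low_exponents_le_4_power:
  assumes "finite I" "p > 0"
  shows "card (low_exponents I p) \<le> 4 ^ card I"
proof -
  have "(1/2 :: real) ^ card I \<le> (1/2) ^ sum e I" if "e \<in> low_exponents I p" for e
  proof (rule power_decreasing)
    have "(p - 1) * card I \<le> p * card I" by simp
    hence "p * sum e I \<le> p * card I"
      using that unfolding low_exponents_def by (blast intro: order.trans)
    thus "sum e I \<le> card I" using assms by simp
  qed auto
  hence "real (card (low_exponents I p)) * (1/2) ^ card I \<le> (\<Sum>e<p. (1/2) ^ e) ^ card I"
    by (intro card_low_exponents_mult_le assms) auto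
  also have "(\<Sum>e<p. (1/2 :: real) ^ e) \<le> 2"
    by (simp add: sum_gp_strict)
  hence "(\<Sum>e<p. (1/2 :: real) ^ e) ^ card I \<le> 2 ^ card I"
    by (intro power_mono sum_nonneg) auto
  finally have "real (card (low_exponents I p)) \<le> 2 ^ card I * 2 ^ card I"
    by (simp add: field_simps)
  also have "\<dots> = real (4 ^ card I)" by (simp flip: power_mult_distrib)
  finally show ?thesis by (simp only: of_nat_le_iff)
qed

text \<open>The weight is \<open>\<gamma> = 0.84 ^ 3\<close>, close to the minimiser of \<open>(1 + \<gamma> + \<gamma>\<^sup>2) / \<gamma> powr (2/3)\<close>.\<close>
lemma card_low_exponents_3_le:
  assumes "finite I"
  shows "real (card (low_exponents I 3)) \<le> 2.756 ^ card I"
proof -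
  \<comment> \<open>The condition \<open>3 * sum e I \<le> 2 * card I\<close> compares exponents of
    0.84 directly; writing \<open>\<gamma>\<close> as a cube avoids fractional powers.\<close>
  have "((0.84 :: real)\<^sup>2) ^ card I \<le> (0.84 ^ 3) ^ sum e I" if "e \<in> low_exponents I 3" for e
    unfolding power_mult[symmetric] using that
    by (intro power_decreasing) (auto simp: low_exponents_def)
  hence "real (card (low_exponents I 3)) * ((0.84)\<^sup>2) ^ card I \<le> (\<Sum>e<3. (0.84 ^ 3) ^ e) ^ card I"
    by (intro card_low_exponents_mult_le assms) auto
  also have "\<dots> \<le> (2.756 * (0.84)\<^sup>2) ^ card I"
    by (intro power_mono sum_nonneg) (auto simp: eval_nat_numeral)
  finally have "real (card (low_exponents I 3)) * ((0.84)\<^sup>2) ^ card I \<le> 2.756 ^ card I * ((0.84)\<^sup>2) ^ card I"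
    by (simp only: power_mult_distrib)
  thus ?thesis by (rule mult_right_le_imp_le) simp
qed

section \<open>Sets without \<open>p\<close> distinct elements of sum zero\<close>

text \<open>The space \<open>F_q^C\<close>, realised by functions vanishing off \<open>C\<close> so
  that all supports share one pointwise ring.\<close>

definition vectors_on :: "'c set \<Rightarrow> ('c \<Rightarrow> 'a::zero) set" where
  "vectors_on C = {x. \<forall>c. c \<notin> C \<longrightarrow> x c = 0}"

lemma finite_vectors_on: "finite C \<Longrightarrow> finite (vectors_on C :: ('c \<Rightarrow> 'a::{finite,zero}) set)"
  and card_vectors_on: "finite C \<Longrightarrow> card (vectors_on C :: ('c \<Rightarrow> 'a) set) \<le> CARD('a) ^ card C"
proof -
  assume C: "finite C"
  let ?f = "\<lambda>(x :: 'c \<Rightarrow> 'a) c. if c \<in> C then x c else 0"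
  have sub: "vectors_on C \<subseteq> ?f ` (C \<rightarrow>\<^sub>E UNIV)"
  proof
    fix x :: "'c \<Rightarrow> 'a" assume "x \<in> vectors_on C"
    hence "x = ?f (restrict x C)" by (auto simp: vectors_on_def fun_eq_iff)
    thus "x \<in> ?f ` (C \<rightarrow>\<^sub>E UNIV)" by (rule image_eqI[of _ ?f "restrict x C"]) simp
  qed
  have fin: "finite (C \<rightarrow>\<^sub>E (UNIV :: 'a set))" using C by (simp add: finite_PiE)
  show "finite (vectors_on C :: ('c \<Rightarrow> 'a) set)"
    using sub fin by (rule finite_subset[OF _ finite_imageI])
  have "card (vectors_on C :: ('c \<Rightarrow> 'a) set) \<le> card (C \<rightarrow>\<^sub>E (UNIV :: 'a set))"
    using card_mono[OF finite_imageI[OF fin] sub] card_image_le[OF fin, of ?f] by linarith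
  thus "card (vectors_on C :: ('c \<Rightarrow> 'a) set) \<le> CARD('a) ^ card C"
    using C by (simp add: card_PiE)
qed

text \<open>In characteristic 3, \<open>a + a + c = 0\<close> forces \<open>c = a\<close>, so a
  zero-sum triple is constant or has three distinct entries. The slice rank bound therefore applies
  without regrouping.\<close>

lemma card_no_3_zero_sum_le:
  fixes A :: "('c \<Rightarrow> 'a::{finite,field}) set"
  assumes C: "finite C" and q: "CARD('a) = 3 ^ k" and A: "A \<subseteq> vectors_on C"
    and no: "\<nexists>S. S \<subseteq> A \<and> card S = 3 \<and> \<Sum>S = 0"
  shows "real (card A) \<le> 3 * (2.756 ^ k) ^ card C"
proof -
  have char: "CHAR('a) = 3" by (rule CHAR_eq_of_CARD[OF _ q]) simp
  have three: "a + a + a = 0" for a :: "'c \<Rightarrow> 'a"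
  proof
    fix c
    have "(a + a + a) c = of_nat 3 * a c" by (simp add: algebra_simps)
    also have "of_nat 3 = (0 :: 'a)" using char of_nat_CHAR[where 'a = 'a] by metis
    finally show "(a + a + a) c = 0 c" by simp
  qed
  have "card A \<le> 3 * card (low_exponents (C \<times> {..<k}) 3)"
  proof (rule card_zero_sum_free_le[OF _ C _ q])
    fix x :: "nat \<Rightarrow> 'c \<Rightarrow> 'a" assume x: "\<And>j. j < 3 \<Longrightarrow> x j \<in> A" "(\<Sum>j<3. x j) = 0"
    have sum0: "x 0 + x 1 + x 2 = 0" using x(2) by (simp add: eval_nat_numeral add_ac)
    have third: "c = a" if "a + a + c = 0" for a c :: "'c \<Rightarrow> 'a"
      using three[of a] that by (metis add_left_cancel)
    have "x 0 = x 1 \<and> x 1 = x 2"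
    proof (rule ccontr)
      assume neq: "\<not> ?thesis"
      have "x 0 \<noteq> x 1" using third[of "x 0" "x 2"] sum0 neq by auto
      moreover have "x 1 \<noteq> x 2" using third[of "x 1" "x 0"] sum0 neq by (auto simp: add.assoc add.commute)
      moreover have "x 0 \<noteq> x 2" using third[of "x 0" "x 1"] sum0 neq by (auto simp: add.assoc add.commute)
      ultimately have "card {x 0, x 1, x 2} = 3" "\<Sum>{x 0, x 1, x 2} = 0"
        using sum0 by (simp_all add: add.assoc)
      moreover have "{x 0, x 1, x 2} \<subseteq> A" using x(1) by simp
      ultimately show False using no by blast
    qed
    hence "\<forall>j\<in>{0, 1, 2}. x j = x 0" by simp
    moreover have "{..<3} = {0, 1, 2 :: nat}" by auto
    ultimately show "\<forall>j<3. x j = x 0" by (metis lessThan_iff)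
  qed (use A finite_subset[OF A finite_vectors_on[OF C]] in \<open>auto simp: vectors_on_def\<close>)
  hence "real (card A) \<le> 3 * real (card (low_exponents (C \<times> {..<k}) 3))" by linarith
  also have "\<dots> \<le> 3 * 2.756 ^ card (C \<times> {..<k})"
    using C by (intro mult_left_mono card_low_exponents_3_le) auto
  also have "card (C \<times> {..<k}) = k * card C" by (simp add: card_cartesian_product)
  finally show ?thesis unfolding power_mult .
qed

text \<open>Slice rank gives \<open>M = 3 * 4 ^ (card C * k)\<close>, and the ambient space has at
  most \<open>CARD('a) ^ card C\<close> elements. The square root of the product yields the base
  \<open>2 ^ k * sqrt (CARD('a))\<close>.\<close>

lemma card_no_zero_sum_le:
  fixes A :: "('c \<Rightarrow> 'a::{finite,field}) set"
  assumes C: "finite C" and p: "prime p" "odd p" and q: "CARD('a) = p ^ k" and A: "A \<subseteq> vectors_on C"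
    and no: "\<nexists>S. S \<subseteq> A \<and> card S = p \<and> \<Sum>S = 0"
  shows "real (card A) \<le> sqrt (3 * (1 + p ^ 3 * (4 * p + 1))) * (2 ^ k * sqrt (CARD('a))) ^ card C"
proof -
  have char: "CHAR('a) = p" by (rule CHAR_eq_of_CARD[OF p(1) q])
  interpret torsion_subset p "vectors_on C :: ('c \<Rightarrow> 'a) set" A
  proof
    have "of_nat p * (1 :: 'c \<Rightarrow> 'a) = 0"
    proof
      fix c
      have "(of_nat n * (1 :: 'c \<Rightarrow> 'a)) c = of_nat n" for n
        by (induction n) (simp_all add: distrib_right)
      thus "(of_nat p * (1 :: 'c \<Rightarrow> 'a)) c = 0 c"
        using char of_nat_CHAR[where 'a = 'a] by auto
    qed
    thus "of_nat p = (0 :: 'c \<Rightarrow> 'a)" by simp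
  qed (use p C A finite_vectors_on[OF C] in \<open>auto simp: vectors_on_def\<close>)
  have "(card A)\<^sup>2 \<le> (3 * 4 ^ (card C * k)) * ((1 + p ^ 3 * (4 * p + 1)) * card (vectors_on C :: ('c \<Rightarrow> 'a) set))"
  proof (rule card_square_le[OF no])
    fix B assume B: "B \<subseteq> A" "\<And>x. (\<And>j. j < p \<Longrightarrow> x j \<in> B) \<Longrightarrow> (\<Sum>j<p. x j) = 0 \<Longrightarrow> \<forall>j<p. x j = x 0"
    have "card B \<le> 3 * card (low_exponents (C \<times> {..<k}) p)"
      by (rule card_zero_sum_free_le[OF _ C p(1) q _ B(2)])
         (use B(1) A finite_A finite_subset in \<open>auto simp: vectors_on_def\<close>)
    also have "\<dots> \<le> 3 * 4 ^ card (C \<times> {..<k})"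
      using C prime_gt_0_nat[OF p(1)] by (intro mult_left_mono card_low_exponents_le_4_power) auto
    finally show "card B \<le> 3 * 4 ^ (card C * k)" by (simp add: card_cartesian_product)
  qed
  also have "\<dots> \<le> (3 * 4 ^ (card C * k)) * ((1 + p ^ 3 * (4 * p + 1)) * CARD('a) ^ card C)"
    using card_vectors_on[OF C, where 'a = 'a] by (intro mult_left_mono) auto
  finally have "(real (card A))\<^sup>2 \<le> real (3 * (1 + p ^ 3 * (4 * p + 1))) * (4 ^ (card C * k) * real CARD('a) ^ card C)"
    unfolding of_nat_power[symmetric] of_nat_le_iff[symmetric, where 'a = real] by (simp add: algebra_simps)
  also have "4 ^ (card C * k) * real CARD('a) ^ card C = ((2 ^ k * sqrt (CARD('a))) ^ card C)\<^sup>2"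
  proof -
    have "((2 ^ k * sqrt (CARD('a))) ^ card C)\<^sup>2 = ((2 ^ k)\<^sup>2 * (sqrt (CARD('a)))\<^sup>2) ^ card C"
      by (simp only: power_mult_distrib power_mult[symmetric] mult_ac)
    also have "(2 ^ k)\<^sup>2 = (4 :: real) ^ k"
      by (metis power2_eq_square power_mult_distrib num_double numeral_times_numeral)
    finally show ?thesis
      by (simp add: power_mult_distrib power_mult[symmetric] mult.commute[of k])
  qed
  finally have "sqrt ((real (card A))\<^sup>2) \<le> sqrt (real (3 * (1 + p ^ 3 * (4 * p + 1))) * ((2 ^ k * sqrt (CARD('a))) ^ card C)\<^sup>2)"
    by (rule real_sqrt_le_mono)
  thus ?thesis by (simp add: real_sqrt_mult)
qed

section \<open>From symmetric functions to sums of inverses\<close>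

lemma esym_card_minus_1:
  assumes "card T = p" "p > 0"
  shows "esym (p - 1) g T = (\<Sum>i\<in>T. \<Prod>l\<in>T - {i}. g l)"
proof -
  have fin: "finite T" using assms card_ge_0_finite by blast
  have "{U. U \<subseteq> T \<and> card U = p - 1} = (\<lambda>i. T - {i}) ` T"
  proof (intro equalityI subsetI)
    fix U assume U: "U \<in> {U. U \<subseteq> T \<and> card U = p - 1}"
    hence "card (T - U) = 1"
      using assms fin by (subst card_Diff_subset) (auto intro: finite_subset)
    then obtain i where "T - U = {i}" by (auto simp: card_1_singleton_iff)
    hence "i \<in> T" "U = T - {i}" using U by blast+
    thus "U \<in> (\<lambda>i. T - {i}) ` T" by blast
  qed (use assms fin in auto)
  moreover have "inj_on (\<lambda>i. T - {i}) T" by (auto simp: inj_on_def)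
  ultimately show ?thesis
    unfolding esym_def by (simp add: sum.reindex)
qed

text \<open>If no entry vanishes, \<open>e_{p-1}\<close> is the product of all entries times the sum
  of their inverses. If all vanish, every summand is a nonempty product of zeros.\<close>

lemma esym_eq_0I:
  fixes g :: "nat \<Rightarrow> 'a::field"
  assumes "card T = p" "p \<ge> 3"
    and "(\<forall>i\<in>T. g i = 0) \<or> (\<forall>i\<in>T. g i \<noteq> 0) \<and> (\<Sum>i\<in>T. inverse (g i)) = 0"
  shows "esym (p - 1) g T = 0"
proof -
  have fin: "finite T" using assms by (metis card.infinite not_numeral_le_zero)
  show ?thesis
    using assms(3)
  proof
    assume zero: "\<forall>i\<in>T. g i = 0"
    have "(\<Prod>l\<in>T - {i}. g l) = 0" if "i \<in> T" for i
    proof -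
      have "card (T - {i}) \<noteq> 0" using that assms fin by simp
      then obtain l where "l \<in> T - {i}" by (metis card.empty equals0I)
      thus ?thesis using zero fin by (intro prod_zero) auto
    qed
    thus ?thesis using assms by (subst esym_card_minus_1) auto
  next
    assume nz: "(\<forall>i\<in>T. g i \<noteq> 0) \<and> (\<Sum>i\<in>T. inverse (g i)) = 0"
    have "(\<Sum>i\<in>T. \<Prod>l\<in>T - {i}. g l) = (\<Sum>i\<in>T. (\<Prod>l\<in>T. g l) * inverse (g i))"
      using nz fin by (intro sum.cong refl) (simp add: prod.remove)
    also have "\<dots> = 0" using nz by (simp add: sum_distrib_left[symmetric])
    finally show ?thesis using assms by (subst esym_card_minus_1) auto
  qed
qed

text \<open>Equal inverse vectors occur at most \<open>p - 1\<close> times, since \<open>p\<close>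
  copies sum to zero; over all vectors this alone gives the second bound. For the first one,
  \<open>bound\<close> is applied to the distinct inverse vectors of each support class.\<close>

lemma length_le_of_no_subsequence:
  fixes S :: "nat \<Rightarrow> nat \<Rightarrow> 'a::{finite,field}"
  assumes p: "p \<ge> 3" "of_nat p = (0 :: 'a)" and K: "K \<ge> 0"
    and no: "\<nexists>T. T \<subseteq> {..<L} \<and> card T = p \<and> (\<forall>j<n. esym (p - 1) (\<lambda>i. S i j) T = 0)"
    and bound: "\<And>C A. C \<subseteq> {..<n} \<Longrightarrow> A \<subseteq> (vectors_on C :: (nat \<Rightarrow> 'a) set) \<Longrightarrow>
      \<nexists>S. S \<subseteq> A \<and> card S = p \<and> \<Sum>S = 0 \<Longrightarrow> real (card A) \<le> K * B ^ card C"
  shows "real L \<le> real (p - 1) * K * (B + 1) ^ n"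
    and "L \<le> (p - 1) * CARD('a) ^ n"
proof -
  define u where "u i = (\<lambda>j. if j < n then inverse (S i j) else 0)" for i
  define supp where "supp i = {j. j < n \<and> S i j \<noteq> 0}" for i
  define A where "A C = u ` {i\<in>{..<L}. supp i = C}" for C
  have no_T: False
    if T: "T \<subseteq> {i\<in>{..<L}. supp i = C}" "card T = p" "sum u T = 0" for T C
  proof -
    have "\<forall>j<n. esym (p - 1) (\<lambda>i. S i j) T = 0"
    proof (intro allI impI, rule esym_eq_0I[OF T(2) p(1)])
      fix j assume j: "j < n"
      have "(\<Sum>i\<in>T. inverse (S i j)) = sum u T j"
        using j by (simp add: sum_fun_apply u_def)
      moreover have "S i j \<noteq> 0 \<longleftrightarrow> j \<in> C" if "i \<in> T" for i
        using that T(1) j by (auto simp: supp_def)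
      ultimately show "(\<forall>i\<in>T. S i j = 0) \<or> (\<forall>i\<in>T. S i j \<noteq> 0) \<and> (\<Sum>i\<in>T. inverse (S i j)) = 0"
        unfolding T(3) by (cases "j \<in> C") simp_all
    qed
    moreover have "T \<subseteq> {..<L}" using T(1) by blast
    ultimately have "\<exists>T. T \<subseteq> {..<L} \<and> card T = p \<and> (\<forall>j<n. esym (p - 1) (\<lambda>i. S i j) T = 0)"
      by (intro exI[of _ T] conjI T(2))
    with no show False by (rule notE)
  qed
  \<comment> \<open>Since \<open>inverse\<close> vanishes only at 0, the inverse vector determines
    the support class.\<close>
  have supp_u: "supp i = {j. u i j \<noteq> 0}" for i
    by (auto simp: u_def supp_def)
  have fibre: "card {i\<in>P. u i = s} \<le> p - 1" if P: "P \<subseteq> {..<L}" for P s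
  proof (rule ccontr)
    assume "\<not> ?thesis"
    hence "p \<le> card {i\<in>P. u i = s}" by simp
    then obtain T where T: "T \<subseteq> {i\<in>P. u i = s}" "card T = p"
      by (rule obtain_subset_with_card_n)
    have "T \<noteq> {}" using T(2) p(1) by auto
    then obtain i where i: "i \<in> T" by blast
    have T': "T \<subseteq> {i'\<in>{..<L}. supp i' = supp i}"
    proof
      fix i' assume "i' \<in> T"
      hence "i' < L" "u i' = u i" using T(1) i P by auto
      thus "i' \<in> {i'\<in>{..<L}. supp i' = supp i}" by (simp add: supp_u)
    qed
    have "sum u T = 0"
    proof
      fix j
      have "sum u T j = (\<Sum>i\<in>T. s j)" unfolding sum_fun_apply using T(1) by (intro sum.cong) auto
      thus "sum u T j = 0 j" using T(2) p(2) by simp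
    qed
    thus False by (rule no_T[OF T' T(2)])
  qed
  have finA: "finite (A C)" for C by (simp add: A_def)
  have "u ` {..<L} \<subseteq> vectors_on {..<n}" by (auto simp: u_def vectors_on_def)
  hence "card {..<L} \<le> (p - 1) * card (vectors_on {..<n} :: (nat \<Rightarrow> 'a) set)"
    using fibre[of "{..<L}"] by (intro card_le_fibres[where f = u] finite_vectors_on) auto
  also have "\<dots> \<le> (p - 1) * CARD('a) ^ n"
    using card_vectors_on[of "{..<n}", where 'a = 'a] by (intro mult_left_mono) auto
  finally show "L \<le> (p - 1) * CARD('a) ^ n" by simp
  have class_le: "real (card {i\<in>{..<L}. supp i = C}) \<le> real (p - 1) * (K * B ^ card C)" if C: "C \<subseteq> {..<n}" for C
  proof -
    have "card {i\<in>{..<L}. supp i = C} \<le> (p - 1) * card (A C)"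
      using fibre[of "{i\<in>{..<L}. supp i = C}"] finA
      by (intro card_le_fibres[where f = u]) (auto simp: A_def)
    hence "real (card {i\<in>{..<L}. supp i = C}) \<le> real (p - 1) * real (card (A C))"
      by (metis of_nat_le_iff of_nat_mult)
    also have "real (card (A C)) \<le> K * B ^ card C"
    proof (rule bound[OF C], rule_tac [2] notI)
      show "A C \<subseteq> vectors_on C"
        by (auto simp: A_def vectors_on_def u_def supp_def split: if_splits)
      assume "\<exists>S\<subseteq>A C. card S = p \<and> \<Sum>S = 0"
      then obtain V where V: "V \<subseteq> A C" "card V = p" "\<Sum>V = 0" by blast
      \<comment> \<open>\<open>V\<close> is a set of values; one index is chosen for each.\<close>
      then obtain T where T: "T \<subseteq> {i\<in>{..<L}. supp i = C}" "inj_on u T" "V = u ` T"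
        unfolding A_def by (auto simp: subset_image_inj)
      have "card T = p" "sum u T = 0"
        using V T by (simp_all add: card_image sum.reindex)
      thus False by (rule no_T[OF T(1)])
    qed
    finally show ?thesis by (simp add: mult_left_mono)
  qed
  have "supp i \<in> Pow {..<n}" for i by (auto simp: supp_def)
  hence "{..<L} = (\<Union>C\<in>Pow {..<n}. {i\<in>{..<L}. supp i = C})" by blast
  hence "card {..<L} = card (\<Union>C\<in>Pow {..<n}. {i\<in>{..<L}. supp i = C})" by (rule arg_cong)
  also have "\<dots> \<le> (\<Sum>C\<in>Pow {..<n}. card {i\<in>{..<L}. supp i = C})"
    by (rule card_UN_le) simp
  finally have "L \<le> (\<Sum>C\<in>Pow {..<n}. card {i\<in>{..<L}. supp i = C})"
    by (simp only: card_lessThan)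
  hence "real L \<le> (\<Sum>C\<in>Pow {..<n}. real (card {i\<in>{..<L}. supp i = C}))"
    by (simp only: of_nat_le_iff of_nat_sum[symmetric])
  also have "\<dots> \<le> (\<Sum>C\<in>Pow {..<n}. real (p - 1) * (K * B ^ card C))"
    by (rule sum_mono, rule class_le, rule PowD)
  also have "\<dots> = real (p - 1) * K * (\<Sum>C\<in>Pow {..<n}. B ^ card C)"
    by (simp only: sum_distrib_left mult.assoc)
  \<comment> \<open>The binomial theorem, as the expansion of a product over the
    coordinates.\<close>
  also have "(\<Sum>C\<in>Pow {..<n}. B ^ card C) = (\<Prod>j<n. B + 1)"
    unfolding prod_add[OF finite_lessThan] by (simp only: prod_constant power_one mult_1_right)
  also have "\<dots> = (B + 1) ^ n" by (simp only: prod_constant card_lessThan)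
  finally show "real L \<le> real (p - 1) * K * (B + 1) ^ n" .
qed

section \<open>Passage to the asymptotic statement\<close>

text \<open>The constant is absorbed into the exponent: with \<open>h = log B (K + 1)\<close>, a
  constant and hence \<open>o(n)\<close>, the length \<open>l\<close> is at most
  \<open>(K + 1) * B ^ n = B powr (n + h)\<close>.\<close>

lemma asymp_boundI:
  assumes B: "B > 1" and K: "K \<ge> 0"
    and bound: "\<And>n L (S :: nat \<Rightarrow> nat \<Rightarrow> 'a::field).
      \<nexists>T. T \<subseteq> {..<L} \<and> card T = t \<and> (\<forall>j<n. esym m (\<lambda>i. S i j) T = 0) \<Longrightarrow> real L \<le> K * B ^ n"
  shows "asymp_bound (\<lambda>d. EGZ t TYPE('a) d m) B"
  unfolding asymp_bound_def
proof (intro exI[of _ "\<lambda>_. log B (K + 1)"] conjI always_eventually allI)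
  define h where "h = log B (K + 1)"
  show "(\<lambda>_. log B (K + 1)) \<in> o(\<lambda>n. real n)"
    by (rule smalloI_tendsto[OF lim_const_over_n])
       (auto intro: eventually_mono[OF eventually_gt_at_top[of 0]])
  fix n
  define l where "l = Suc (nat \<lfloor>K * B ^ n\<rfloor>)"
  have KB: "K * B ^ n \<ge> 0" using K B by simp
  hence l: "K * B ^ n < real l" "real l \<le> K * B ^ n + 1" by (simp_all add: l_def) linarith+
  have "egz_good t n m TYPE('a) l"
    unfolding egz_good_def
  proof (intro allI impI, rule ccontr)
    fix L and S :: "nat \<Rightarrow> nat \<Rightarrow> 'a"
    assume "l \<le> L" "\<nexists>T. T \<subseteq> {..<L} \<and> card T = t \<and> (\<forall>j<n. esym m (\<lambda>i. S i j) T = 0)"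
    thus False using bound[of L n S] l by simp
  qed
  moreover have "l > 0" by (simp add: l_def)
  ultimately have ex: "\<exists>l>0. egz_good t n m TYPE('a) l"
    and le: "(LEAST l. l > 0 \<and> egz_good t n m TYPE('a) l) \<le> l"
    by (auto intro: Least_le)
  from ex have EGZ: "EGZ t TYPE('a) n m = enat (LEAST l. l > 0 \<and> egz_good t n m TYPE('a) l)"
    unfolding EGZ_def by (rule if_P)
  have "real l \<le> K * B ^ n + 1 * B ^ n"
    using l(2) B by (smt (verit) mult_1 one_le_power)
  also have "\<dots> = B powr (real n + h)"
    using B K by (simp add: h_def powr_add powr_realpow algebra_simps)
  finally show "\<exists>N. EGZ t TYPE('a) n m = enat N \<and> real N \<le> B powr (real n + log B (K + 1))"
    unfolding h_def[symmetric] using EGZ le by (meson of_nat_le_iff order.trans)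
qed

theorem theorem4p3:
  fixes p k n :: nat
  assumes "prime p" and "odd p" and "k > 0" and "n > 0"
  shows "((\<not> (\<exists>j. CARD('a) = p ^ j)) \<longrightarrow> EGZ p TYPE('a::{finite,field}) n (p - 1) = \<infinity>)
    \<and> (CARD('a) = p ^ k \<longrightarrow>
         ((p = 3 \<or> p = 5) \<and> k = 1 \<longrightarrow>
            asymp_bound (\<lambda>d. EGZ p TYPE('a) d (p - 1)) (real CARD('a)))
       \<and> (p = 3 \<and> k \<ge> 2 \<longrightarrow>
            asymp_bound (\<lambda>d. EGZ p TYPE('a) d (p - 1)) (2.756 ^ k + 1))
       \<and> (p \<noteq> 3 \<and> CARD('a) \<ge> 7 \<longrightarrow>
            asymp_bound (\<lambda>d. EGZ p TYPE('a) d (p - 1)) (2 ^ k * sqrt (real CARD('a)) + 1)))"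
proof -
  have "p \<noteq> 2" using assms(2) by auto
  hence p3: "p \<ge> 3" using prime_ge_2_nat[OF assms(1)] by simp
  have infinite: "EGZ p TYPE('a) n (p - 1) = \<infinity>" if no: "\<nexists>j. CARD('a) = p ^ j"
  proof -
    have ne: "of_nat p \<noteq> (0 :: 'a)"
    proof
      assume "of_nat p = (0 :: 'a)"
      hence "CHAR('a) = p" by (rule CHAR_eqI[OF assms(1)])
      thus False using no CARD_eq_power_CHAR[where 'a = 'a] by simp
    qed
    have "\<not> egz_good p n (p - 1) TYPE('a) l" for l
    proof
      assume "egz_good p n (p - 1) TYPE('a) l"
      hence "\<exists>T. T \<subseteq> {..<l} \<and> card T = p \<and> (\<forall>j<n. esym (p - 1) (\<lambda>_. 1 :: 'a) T = 0)"
        unfolding egz_good_def by (elim allE[of _ l] allE[of _ "\<lambda>_ _. 1"] impE) simp_all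
      \<comment> \<open>Positivity of \<open>n\<close> supplies a coordinate at which the vanishing
        can be read off.\<close>
      then obtain T where T: "card T = p" "esym (p - 1) (\<lambda>_. 1 :: 'a) T = 0"
        using assms(4) by metis
      have "esym (p - 1) (\<lambda>_. 1 :: 'a) T = of_nat p"
        using T(1) p3 by (subst esym_card_minus_1) auto
      thus False using ne T(2) by simp
    qed
    thus ?thesis by (simp add: EGZ_def)
  qed
  have finite_bounds: "asymp_bound (\<lambda>d. EGZ p TYPE('a) d (p - 1)) (real CARD('a))"
      "asymp_bound (\<lambda>d. EGZ p TYPE('a) d (p - 1)) (2 ^ k * sqrt (real CARD('a)) + 1)"
      "p = 3 \<Longrightarrow> asymp_bound (\<lambda>d. EGZ p TYPE('a) d (p - 1)) (2.756 ^ k + 1)"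
    if q: "CARD('a) = p ^ k"
  proof -
    have p0: "of_nat p = (0 :: 'a)"
      using CHAR_eq_of_CARD[OF assms(1) q] of_nat_CHAR[where 'a = 'a] by metis
    define K where "K = sqrt (3 * (1 + p ^ 3 * (4 * p + 1)))"
    have K: "K \<ge> 0" by (simp add: K_def)
    have bound: "real (card A) \<le> K * (2 ^ k * sqrt (CARD('a))) ^ card C"
      if "C \<subseteq> {..<n}" "A \<subseteq> (vectors_on C :: (nat \<Rightarrow> 'a) set)" "\<nexists>S. S \<subseteq> A \<and> card S = p \<and> \<Sum>S = 0"
      for n C and A :: "(nat \<Rightarrow> 'a) set"
      using card_no_zero_sum_le[OF finite_subset[OF that(1)] assms(1,2) q that(2,3)] by (simp add: K_def)
    have q0: "CARD('a) > 1" using card_mono[of UNIV "{0, 1 :: 'a}"] by simp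
    show "asymp_bound (\<lambda>d. EGZ p TYPE('a) d (p - 1)) (real CARD('a))"
    proof (rule asymp_boundI)
      fix n L and S :: "nat \<Rightarrow> nat \<Rightarrow> 'a"
      assume "\<nexists>T. T \<subseteq> {..<L} \<and> card T = p \<and> (\<forall>j<n. esym (p - 1) (\<lambda>i. S i j) T = 0)"
      hence "L \<le> (p - 1) * CARD('a) ^ n"
        by (rule length_le_of_no_subsequence(2)[OF p3 p0 K _ bound])
      hence "real L \<le> real ((p - 1) * CARD('a) ^ n)" by (simp only: of_nat_le_iff)
      thus "real L \<le> real (p - 1) * real CARD('a) ^ n" by (simp only: of_nat_mult of_nat_power)
    qed (use q0 in auto)
    show "asymp_bound (\<lambda>d. EGZ p TYPE('a) d (p - 1)) (2 ^ k * sqrt (real CARD('a)) + 1)"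
    proof (rule asymp_boundI)
      fix n L and S :: "nat \<Rightarrow> nat \<Rightarrow> 'a"
      assume "\<nexists>T. T \<subseteq> {..<L} \<and> card T = p \<and> (\<forall>j<n. esym (p - 1) (\<lambda>i. S i j) T = 0)"
      thus "real L \<le> real (p - 1) * K * (2 ^ k * sqrt (real CARD('a)) + 1) ^ n"
        by (rule length_le_of_no_subsequence(1)[OF p3 p0 K _ bound])
    qed (use K q0 in auto)
    show "asymp_bound (\<lambda>d. EGZ p TYPE('a) d (p - 1)) (2.756 ^ k + 1)" if "p = 3"
    proof (rule asymp_boundI)
      fix n L and S :: "nat \<Rightarrow> nat \<Rightarrow> 'a"
      assume no: "\<nexists>T. T \<subseteq> {..<L} \<and> card T = p \<and> (\<forall>j<n. esym (p - 1) (\<lambda>i. S i j) T = 0)"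
      show "real L \<le> real (p - 1) * 3 * (2.756 ^ k + 1) ^ n"
      proof (rule length_le_of_no_subsequence(1)[OF p3 p0 _ no])
        fix C and A :: "(nat \<Rightarrow> 'a) set"
        assume "C \<subseteq> {..<n}" "A \<subseteq> vectors_on C" "\<nexists>S. S \<subseteq> A \<and> card S = p \<and> \<Sum>S = 0"
        thus "real (card A) \<le> 3 * (2.756 ^ k) ^ card C"
          using q unfolding \<open>p = 3\<close>
          by (intro card_no_3_zero_sum_le finite_subset[OF _ finite_lessThan])
      qed simp
    qed auto
  qed
  show ?thesis
    by (intro conjI impI; (rule infinite | rule finite_bounds); simp)
qed

end
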